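(* Let $r>0$ be an integer that is not a prime power, and let $X$ be a complex with a free action of the permutation group $\Sigma_r$. Then there is a $\Sigma_r$-equivariant map $X\to \mathbb{R}^{2\times r}-\delta_r$.
   Context: A complex is a collection of closed faces (= simplices) of some (finite-dimensional) simplex, i.e. a finite simplicial complex; it is identified with its body (the union of its simplices). An action of a finite group on a complex is an action on its body that is PL, i.e. compatible with (simplicial for) some structure of a complex on the body. All maps are continuous. $\Sigma_r$ is the permutation group of $r$ elements. $\mathbb{R}^{2\times r}:=(\mathbb{R}^2)^r$ is the set of real $2\times r$-matrices, on which $\Sigma_r$ acts by permuting the columns. The diagonal is $\delta_r:=\{(x,x,\ldots,x)\in\mathbb{R}^{2\times r}\ |\ x\in\mathbb{R}^2\}$. Convention: $1=p^0$ counts as a prime power, so "$r$ is not a prime power" implies $r\ge 6$. *)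

theory Defs
  imports
    "HOL-Analysis.Analysis"
    "HOL-Algebra.Group_Action"
    "HOL-Computational_Algebra.Primes"
begin

text \<open>
  Complexes are finite geometric simplicial complexes, \<^const>\<open>simplicial_complex\<close> from
  HOL-Analysis; the body of \<open>K\<close> is \<open>\<Union>K\<close>.  The library counts the empty set as the
  simplex of dimension \<open>-1\<close>.
\<close>

definition affine_map_on :: "'a::real_vector set \<Rightarrow> ('a \<Rightarrow> 'b::real_vector) \<Rightarrow> bool" where
  "affine_map_on S f \<longleftrightarrow>
     (\<forall>x\<in>S. \<forall>y\<in>S. \<forall>t\<in>{0..1}. f ((1 - t) *\<^sub>R x + t *\<^sub>R y) = (1 - t) *\<^sub>R f x + t *\<^sub>R f y)"

definition simplicial_map ::
  "'a::euclidean_space set set \<Rightarrow> 'b::euclidean_space set set \<Rightarrow> ('a \<Rightarrow> 'b) \<Rightarrow> bool" where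
  "simplicial_map K L f \<longleftrightarrow>
     (\<forall>S\<in>K. (\<exists>T\<in>L. f ` {v. v extreme_point_of S} \<subseteq> {w. w extreme_point_of T}) \<and>
             affine_map_on S f)"

text \<open>
  The structure \<open>T\<close> for which the action is simplicial is an arbitrary triangulation of the
  body; it need not be \<open>K\<close> itself.
\<close>

definition complex_action ::
  "('g, 'm) monoid_scheme \<Rightarrow> 'a::euclidean_space set set \<Rightarrow> ('g \<Rightarrow> 'a \<Rightarrow> 'a) \<Rightarrow> bool" where
  "complex_action G K \<phi> \<longleftrightarrow>
     group_action G (\<Union>K) \<phi> \<and>
     (\<exists>T. simplicial_complex T \<and> \<Union>T = \<Union>K \<and>
          (\<forall>g\<in>carrier G. simplicial_map T T (\<phi> g)))"

definition free_action :: "('g, 'm) monoid_scheme \<Rightarrow> 'a set \<Rightarrow> ('g \<Rightarrow> 'a \<Rightarrow> 'a) \<Rightarrow> bool" where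
  "free_action G X \<phi> \<longleftrightarrow> (\<forall>x\<in>X. stabilizer G \<phi> x = {\<one>\<^bsub>G\<^esub>})"

text \<open>
  The space of real \<open>2 \<times> r\<close> matrices is \<open>real^2^'r\<close> with \<open>r = CARD('r)\<close>: the component
  \<open>y $ i\<close> is the \<open>i\<close>-th column.  Accordingly the permutation group of \<open>r\<close> elements is
  \<open>BijGroup (UNIV :: 'r set)\<close>.  The inverse below makes this a left action, as is
  \<^const>\<open>group_action\<close>: column \<open>i\<close> is moved to position \<open>\<sigma> i\<close>.
\<close>

definition permute_columns :: "('r \<Rightarrow> 'r) \<Rightarrow> real^2^'r \<Rightarrow> real^2^'r" where
  "permute_columns \<sigma> y = (\<chi> i. y $ inv_into UNIV \<sigma> i)"

definition diagonal :: "(real^2^'r) set" where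
  "diagonal = {(\<chi> i. x) | x. True}"

end

theory Submission
  imports Defs "HOL-Algebra.Exponent"
begin

text \<open>
  Write \<open>Z\<close> for the set of nonzero vectors with coordinate sum \<open>0\<close> in \<open>\<complex>\<^sup>r\<close>.  With \<open>\<complex>\<close> read as the
  real plane it is contained in the complement of the diagonal, so an equivariant map from the body
  to \<open>Z\<close> suffices.

  \<^bold>\<open>Reduction to a self-map.\<close>  Suppose \<open>Z\<close> has an equivariant self-map \<open>f\<close> that is null-homotopic
  by a homotopy \<open>h\<close> that ignores the group action.  Then a compact free action on
  \<open>X\<close> has an equivariant map to \<open>Z\<close>.  Indeed \<open>X\<close> is covered by finitely many tubes, unions of
  disjoint translates of a small ball, and a map \<open>F\<close> defined on some of the tubes extends over one
  more: on the translates of the ball, replace \<open>f \<circ> F\<close> by the translates of \<open>h\<close> applied to \<open>F\<close>, run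
  so that they are constant before the points outside the domain of \<open>F\<close> are reached.  Each step costs
  one composition with \<open>f\<close>, and this keeps the map equivariant (lemmas \<open>extend_over_tube\<close> and
  \<open>equivariant_map_exists\<close>).

  \<^bold>\<open>The self-map.\<close>  A self-map of degree zero is wanted; the identity has degree one.  For a proper
  nonempty set \<open>A\<close> of indices, the ray \<open>u\<close> through its indicator vector is fixed by the
  permutations that preserve \<open>A\<close>.  On the complex line \<open>\<complex>u\<close>, the identity \<open>z \<mapsto> z\<close> can be replaced by
  \<open>z \<mapsto> z W(z)\<close>, where \<open>W\<close> has winding number \<open>m\<close> and differs from \<open>1\<close> only near the ray; the
  transverse directions are left alone, and no zero arises off the line.  This is where the
  target plane is used: a real line leaves no room for a winding number.  The degree changes by
  \<open>m\<close>, and by \<open>m\<close> times \<open>r choose k\<close> if the change is made equivariantly for all sets of \<open>k\<close> elements.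
  If \<open>r\<close> is not a prime power, then the numbers \<open>r choose k\<close> with \<open>0 < k < r\<close> have no common
  divisor, and the exponents can be chosen to make the total degree zero (lemma
  \<open>binomial_combination\<close>).

  \<^bold>\<open>The null-homotopy.\<close>  The null-homotopy is explicit.  Without regard to the group
  action, the rays can be moved, staying distinct, until they all lie in one complex line \<open>\<complex>q\<close>
  (lemmas \<open>slide_not_parallel\<close> and \<open>homotopic_twist\<close>).  The self-map then acts on the coordinate
  along \<open>q\<close> only, by a function whose winding number is the total degree zero, and a
  contraction can be written down (lemma \<open>twist_collinear_null_homotopic\<close>).
\<close>

section \<open>Equivariant maps out of a free action\<close>

locale continuous_action = group G for G (structure) +
  fixes X :: "'a::metric_space set" and \<phi> :: "'g \<Rightarrow> 'a \<Rightarrow> 'a"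
  assumes act_closed: "\<lbrakk>g \<in> carrier G; x \<in> X\<rbrakk> \<Longrightarrow> \<phi> g x \<in> X"
    and act_one: "x \<in> X \<Longrightarrow> \<phi> \<one> x = x"
    and act_mult: "\<lbrakk>g \<in> carrier G; h \<in> carrier G; x \<in> X\<rbrakk> \<Longrightarrow> \<phi> (g \<otimes> h) x = \<phi> g (\<phi> h x)"
    and act_cont: "g \<in> carrier G \<Longrightarrow> continuous_on X (\<phi> g)"
begin

lemma act_inv_act [simp]:
  assumes "g \<in> carrier G" "x \<in> X" shows "\<phi> (inv g) (\<phi> g x) = x" "\<phi> g (\<phi> (inv g) x) = x"
  using act_mult[of "inv g" g x] act_mult[of g "inv g" x] act_one[of x] assms by auto

end

definition equivariant_map ::
  "('g, 'm) monoid_scheme \<Rightarrow> ('g \<Rightarrow> 'a \<Rightarrow> 'a) \<Rightarrow> ('g \<Rightarrow> 'b \<Rightarrow> 'b) \<Rightarrow>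
     'a::topological_space set \<Rightarrow> 'b::topological_space set \<Rightarrow> ('a \<Rightarrow> 'b) \<Rightarrow> bool" where
  "equivariant_map G \<phi> \<psi> S Z F \<longleftrightarrow>
     continuous_on S F \<and> F \<in> S \<rightarrow> Z \<and> (\<forall>g\<in>carrier G. \<forall>x\<in>S. F (\<phi> g x) = \<psi> g (F x))"

text \<open>
  The homotopy \<open>h\<close> ignores the group.  Freeness of the action on \<open>X\<close> is what makes it usable: it
  is applied over one ball of each tube, and the group carries the result to the other balls.
\<close>
locale null_homotopic_target =
  X: continuous_action G X \<phi> + Z: continuous_action G Z \<psi>
  for G (structure) and X :: "'a::metric_space set" and \<phi>
    and Z :: "'b::metric_space set" and \<psi> +
  fixes f :: "'b \<Rightarrow> 'b" and h :: "real \<times> 'b \<Rightarrow> 'b" and z0 :: 'b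
  assumes finite_group: "finite (carrier G)"
    and f_equivariant: "equivariant_map G \<psi> \<psi> Z Z f"
    and h_cont: "continuous_on ({0..1} \<times> Z) h"
    and h_closed: "h \<in> {0..1} \<times> Z \<rightarrow> Z"
    and h_0: "z \<in> Z \<Longrightarrow> h (0, z) = f z"
    and h_1: "z \<in> Z \<Longrightarrow> h (1, z) = z0"
    and z0: "z0 \<in> Z"
begin

text \<open>
  The function \<open>b\<close> is a bump on a set disjoint from its translates, so at each point \<open>x\<close> at most
  one \<open>g\<close> has \<open>b (\<phi> g x) > 0\<close>.  The new map applies \<open>h\<close> to \<open>F x\<close>, in the coordinates given by
  that \<open>g\<close>, at a time that is \<open>0\<close> on the boundary of the tube and reaches \<open>1\<close> already where
  \<open>b (\<phi> g x) = \<beta> x\<close>, before \<open>F\<close> ceases to be defined.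
\<close>
lemma extend_over_tube:
  fixes \<beta> b :: "'a \<Rightarrow> real"
  assumes \<beta>: "continuous_on X \<beta>" "\<And>x. x \<in> X \<Longrightarrow> 0 \<le> \<beta> x"
      "\<And>g x. \<lbrakk>g \<in> carrier G; x \<in> X\<rbrakk> \<Longrightarrow> \<beta> (\<phi> g x) = \<beta> x"
    and b: "continuous_on X b" "\<And>x. x \<in> X \<Longrightarrow> 0 \<le> b x"
      "\<And>g x. \<lbrakk>g \<in> carrier G; x \<in> X; 0 < b x; 0 < b (\<phi> g x)\<rbrakk> \<Longrightarrow> g = \<one>"
    and F: "equivariant_map G \<phi> \<psi> {x \<in> X. 0 < \<beta> x} Z F"
  shows "\<exists>F'. equivariant_map G \<phi> \<psi> {x \<in> X. 0 < \<beta> x \<or> (\<exists>g\<in>carrier G. 0 < b (\<phi> g x))} Z F'"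
proof -
  let ?O = "{x \<in> X. 0 < \<beta> x}"
  let ?O' = "{x \<in> X. 0 < \<beta> x \<or> (\<exists>g\<in>carrier G. 0 < b (\<phi> g x))}"
  \<comment> \<open>\<open>P g x\<close>: \<open>g\<close> is an admissible coordinate at \<open>x\<close>.  Every \<open>g\<close> is admissible outside the tube; there
      the choice does not influence the value, because \<open>h (0, _)\<close> is the equivariant map \<open>f\<close>.\<close>
  define P where "P g x \<longleftrightarrow> g \<in> carrier G \<and> (\<forall>h\<in>carrier G. h \<noteq> g \<longrightarrow> b (\<phi> h x) = 0)" for g x
  define V where "V g x = (if \<beta> x < b (\<phi> g x) then z0
      else h (min 1 (b (\<phi> g x) / \<beta> x), \<psi> g (F x)))" for g x
  define E where "E g x = \<psi> (inv g) (V g x)" for g x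
  define F' where "F' x = E (SOME g. P g x) x" for x
  have Fc: "continuous_on ?O F" and FZ: "\<And>x. x \<in> ?O \<Longrightarrow> F x \<in> Z"
    and Fe: "\<And>g x. g \<in> carrier G \<Longrightarrow> x \<in> ?O \<Longrightarrow> F (\<phi> g x) = \<psi> g (F x)"
    using F unfolding equivariant_map_def by auto
  have fe: "\<And>g z. g \<in> carrier G \<Longrightarrow> z \<in> Z \<Longrightarrow> f (\<psi> g z) = \<psi> g (f z)" and fZ: "\<And>z. z \<in> Z \<Longrightarrow> f z \<in> Z"
    using f_equivariant unfolding equivariant_map_def by auto
  have b_unique: "g = k" if "g \<in> carrier G" "k \<in> carrier G" "x \<in> X" "0 < b (\<phi> g x)" "0 < b (\<phi> k x)" for g k x
  proof -
    have "\<phi> (k \<otimes> inv g) (\<phi> g x) = \<phi> k x"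
      using that by (simp add: X.act_mult X.act_closed)
    then have "k \<otimes> inv g = \<one>" using b(3)[of "k \<otimes> inv g" "\<phi> g x"] that X.act_closed by auto
    then show ?thesis using that by (metis X.inv_equality X.inv_inv X.inv_closed)
  qed
  have b_nn: "0 \<le> b (\<phi> g x)" if "g \<in> carrier G" "x \<in> X" for g x
    using that b(2) X.act_closed by blast
  have P_ex: "\<exists>g. P g x" if "x \<in> X" for x
  proof (cases "\<exists>g\<in>carrier G. 0 < b (\<phi> g x)")
    case True
    then obtain g where "g \<in> carrier G" "0 < b (\<phi> g x)" by blast
    then have "P g x" unfolding P_def using b_unique[OF _ _ that] b_nn[OF _ that] by (metis antisym_conv1)
    then show ?thesis by blast
  next
    case False
    then have "P \<one> x" unfolding P_def using b_nn[OF _ that] by (metis X.one_closed antisym_conv1)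
    then show ?thesis by blast
  qed
  have P_pos: "P g x" if "g \<in> carrier G" "x \<in> X" "0 < b (\<phi> g x)" for g x
    unfolding P_def using b_unique[OF _ _ that(2)] b_nn[OF _ that(2)] that by (metis antisym_conv1)
  have E0: "E g x = f (F x)" if "x \<in> ?O" "g \<in> carrier G" "b (\<phi> g x) = 0" for g x
  proof -
    have "E g x = \<psi> (inv g) (f (\<psi> g (F x)))"
      using that by (auto simp: E_def V_def h_0 FZ Z.act_closed)
    also have "\<dots> = f (F x)" using that by (simp add: fe FZ fZ)
    finally show ?thesis .
  qed
  have E_eq: "E g x = E k x" if "x \<in> ?O'" "P g x" "P k x" for g k x
  proof (cases "g = k")
    case False
    then have "b (\<phi> g x) = 0" "b (\<phi> k x) = 0" using that unfolding P_def by auto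
    moreover have "x \<in> ?O"
    proof -
      have "b (\<phi> l x) = 0" if "l \<in> carrier G" for l
        using that \<open>P g x\<close> \<open>P k x\<close> False unfolding P_def by metis
      then show ?thesis using that(1) by auto
    qed
    ultimately show ?thesis using E0 that unfolding P_def by auto
  qed auto
  have F'_eq: "F' x = E g x" if "x \<in> ?O'" "P g x" for g x
    unfolding F'_def by (rule E_eq[OF that(1) _ that(2)]) (metis someI that(2))
  have in_O: "x \<in> ?O" if "x \<in> ?O'" "P g x" "\<not> \<beta> x < b (\<phi> g x)" for g x
  proof (rule ccontr)
    assume "x \<notin> ?O"
    then have "\<exists>k\<in>carrier G. 0 < b (\<phi> k x)" and "\<beta> x = 0" using that(1) \<beta>(2)[of x] by auto
    then show False using that unfolding P_def by (metis less_irrefl)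
  qed
  have V_Z: "V g x \<in> Z" if "x \<in> ?O'" "P g x" for g x
  proof (cases "\<beta> x < b (\<phi> g x)")
    case False
    have g: "g \<in> carrier G" using that P_def by auto
    have "(min 1 (b (\<phi> g x) / \<beta> x), \<psi> g (F x)) \<in> {0..1} \<times> Z"
      using in_O[OF that False] g b_nn[OF g] FZ by (auto intro: Z.act_closed)
    then show ?thesis using False h_closed by (auto simp: V_def)
  qed (simp add: V_def z0)
  have E_Z: "E g x \<in> Z" if "x \<in> ?O'" "P g x" for g x
    using V_Z[OF that] that by (auto simp: E_def P_def intro: Z.act_closed)
  have F'_Z: "F' \<in> ?O' \<rightarrow> Z"
  proof
    fix x assume x: "x \<in> ?O'"
    then obtain g where "P g x" using P_ex by blast
    then show "F' x \<in> Z" using E_Z F'_eq x by auto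
  qed
  have F'_equi: "F' (\<phi> k x) = \<psi> k (F' x)" if k: "k \<in> carrier G" and x: "x \<in> ?O'" for k x
  proof -
    have xX: "x \<in> X" using x by auto
    obtain g where P: "P g x" using P_ex[OF xX] by blast
    then have g: "g \<in> carrier G" by (simp add: P_def)
    have sh: "\<phi> l (\<phi> k x) = \<phi> (l \<otimes> k) x" if "l \<in> carrier G" for l
      using that k xX X.act_mult by auto
    have gk: "g \<otimes> inv k \<otimes> k = g" using g k by (simp add: X.m_assoc)
    have P': "P (g \<otimes> inv k) (\<phi> k x)"
      unfolding P_def
    proof (intro conjI ballI impI)
      fix l assume l: "l \<in> carrier G" "l \<noteq> g \<otimes> inv k"
      then have "l \<otimes> k \<noteq> g" using g k by (metis X.inv_solve_right)
      then show "b (\<phi> l (\<phi> k x)) = 0" using P l k sh by (auto simp: P_def)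
    qed (use g k in auto)
    have x': "\<phi> k x \<in> ?O'"
    proof -
      have "\<exists>l\<in>carrier G. 0 < b (\<phi> l (\<phi> k x))" if "m \<in> carrier G" "0 < b (\<phi> m x)" for m
      proof
        have "m \<otimes> inv k \<otimes> k = m" using that(1) k by (simp add: X.m_assoc)
        then show "0 < b (\<phi> (m \<otimes> inv k) (\<phi> k x))" using sh that k by auto
      qed (use that k in auto)
      then show ?thesis using x \<beta>(3)[OF k xX] X.act_closed[OF k xX] by auto
    qed
    have i: "inv (g \<otimes> inv k) = k \<otimes> inv g" using g k by (simp add: X.inv_mult_group)
    have eq: "\<phi> (g \<otimes> inv k) (\<phi> k x) = \<phi> g x" using sh g k gk by auto
    have "V (g \<otimes> inv k) (\<phi> k x) = V g x"
    proof (cases "\<beta> x < b (\<phi> g x)")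
      case False
      then have "x \<in> ?O" using in_O x P by blast
      then have "\<psi> (g \<otimes> inv k) (F (\<phi> k x)) = \<psi> g (F x)"
        using g k Fe FZ by (simp add: Z.act_mult Z.act_closed)
      then show ?thesis unfolding V_def eq using \<beta>(3)[OF k xX] by simp
    qed (simp add: V_def eq \<beta>(3)[OF k xX])
    then have "F' (\<phi> k x) = \<psi> (k \<otimes> inv g) (V g x)"
      using F'_eq[OF x' P'] by (simp add: E_def i)
    also have "\<dots> = \<psi> k (\<psi> (inv g) (V g x))"
      using V_Z[OF x P] g k by (simp add: Z.act_mult)
    also have "\<dots> = \<psi> k (F' x)" using F'_eq[OF x P] by (simp add: E_def)
    finally show ?thesis .
  qed
  have b_cont: "continuous_on X (\<lambda>x. b (\<phi> g x))" if "g \<in> carrier G" for g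
    by (rule continuous_on_compose2[OF b(1) X.act_cont[OF that]]) (use X.act_closed that in auto)
  have E_cont: "continuous_on ?O (E g)" if g: "g \<in> carrier G" for g
  proof -
    have 1: "continuous_on ?O (\<lambda>x. min 1 (b (\<phi> g x) / \<beta> x))"
      by (intro continuous_intros continuous_on_subset[OF b_cont[OF g]] continuous_on_subset[OF \<beta>(1)]) auto
    have 2: "continuous_on ?O (\<lambda>x. \<psi> g (F x))"
      by (rule continuous_on_compose2[OF Z.act_cont[OF g] Fc]) (use FZ in auto)
    have 3: "continuous_on ?O (\<lambda>x. h (min 1 (b (\<phi> g x) / \<beta> x), \<psi> g (F x)))"
      by (rule continuous_on_compose2[OF h_cont continuous_on_Pair[OF 1 2]])
         (use g b_nn[OF g] FZ Z.act_closed in auto)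
    have 4: "continuous_on ?O (\<lambda>x. \<psi> (inv g) (h (min 1 (b (\<phi> g x) / \<beta> x), \<psi> g (F x))))"
      by (rule continuous_on_compose2[OF Z.act_cont 3])
         (use g b_nn[OF g] FZ Z.act_closed h_closed in \<open>auto simp: Pi_iff\<close>)
    show ?thesis
    proof (rule continuous_on_cong[THEN iffD1, OF refl _ 4])
      fix x assume x: "x \<in> ?O"
      show "\<psi> (inv g) (h (min 1 (b (\<phi> g x) / \<beta> x), \<psi> g (F x))) = E g x"
        using x g FZ Z.act_closed h_1 by (auto simp: E_def V_def min_def field_simps)
    qed
  qed
  \<comment> \<open>On the old domain, the sets of points with a given admissible coordinate are finitely many closed
      pieces; where \<open>b (\<phi> g x)\<close> exceeds \<open>\<beta> x\<close>, an open condition, the new map is constant.\<close>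
  have cont_O: "continuous_on ?O F'"
  proof -
    let ?C = "\<lambda>g. {x \<in> ?O. P g x}"
    have cl: "closedin (top_of_set ?O) (?C g)" if g: "g \<in> carrier G" for g
    proof -
      have "continuous_on ?O (\<lambda>x. \<Sum>k\<in>carrier G - {g}. b (\<phi> k x))"
        by (intro continuous_on_sum continuous_on_subset[OF b_cont]) auto
      from continuous_closedin_preimage[OF this closed_singleton]
      have "closedin (top_of_set ?O) (?O \<inter> (\<lambda>x. \<Sum>k\<in>carrier G - {g}. b (\<phi> k x)) -` {0})" .
      also have "?O \<inter> (\<lambda>x. \<Sum>k\<in>carrier G - {g}. b (\<phi> k x)) -` {0} = ?C g"
      proof -
        have "(\<Sum>k\<in>carrier G - {g}. b (\<phi> k x)) = 0 \<longleftrightarrow> P g x" if "x \<in> ?O" for x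
          using sum_nonneg_eq_0_iff[of "carrier G - {g}" "\<lambda>k. b (\<phi> k x)"] finite_group b_nn that g
          unfolding P_def by auto
        then show ?thesis by blast
      qed
      finally show ?thesis .
    qed
    have "continuous_map (top_of_set ?O) euclidean F'"
    proof (rule pasting_lemma_closed[where f = E, OF finite_group cl])
      fix g assume g: "g \<in> carrier G"
      have "continuous_on (?C g) (E g)" by (rule continuous_on_subset[OF E_cont[OF g]]) auto
      moreover have "?O \<inter> ?C g = ?C g" by blast
      ultimately show "continuous_map (subtopology (top_of_set ?O) (?C g)) euclidean (E g)"
        by (simp add: subtopology_subtopology)
    next
      fix x assume x: "x \<in> topspace (top_of_set ?O)"
      then obtain g where "P g x" using P_ex by auto
      then show "\<exists>g. g \<in> carrier G \<and> x \<in> ?C g \<and> F' x = E g x"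
        using F'_eq[of x g] x by (auto simp: P_def)
    qed (use E_eq in auto)
    then show ?thesis by simp
  qed
  let ?W = "\<lambda>g. {x \<in> X. \<beta> x < b (\<phi> g x)}"
  have cont_W: "continuous_on (?W g) F'" if g: "g \<in> carrier G" for g
  proof -
    have "F' x = \<psi> (inv g) z0" if "x \<in> ?W g" for x
    proof -
      have pos: "0 < b (\<phi> g x)" using that \<beta>(2)[of x] by auto
      then have "F' x = E g x" using F'_eq[of x g] P_pos[OF g] that g by auto
      then show ?thesis using that by (simp add: E_def V_def)
    qed
    then show ?thesis using continuous_on_cong[THEN iffD2, OF refl _ continuous_on_const] by blast
  qed
  have "continuous_on ?O' F'"
  proof -
    let ?I = "insert ?O (?W ` carrier G)"
    have sub: "S \<subseteq> ?O'" if "S \<in> ?I" for S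
    proof -
      have "?W g \<subseteq> ?O'" if "g \<in> carrier G" for g
        using that \<beta>(2) le_less_trans by blast
      then show ?thesis using that by blast
    qed
    have opO: "openin (top_of_set X) ?O"
      using continuous_openin_preimage_gen[OF \<beta>(1), of "{0<..}"] by (simp add: vimage_def Int_def)
    have opW: "openin (top_of_set X) (?W g)" if "g \<in> carrier G" for g
      using continuous_openin_preimage_gen[OF continuous_on_diff[OF b_cont[OF that] \<beta>(1)], of "{0<..}"]
      by (simp add: vimage_def Int_def)
    have op: "openin (top_of_set ?O') S" if "S \<in> ?I" for S
    proof -
      have "openin (top_of_set X) S" using that opO opW by blast
      moreover have "?O' \<subseteq> X" by blast
      ultimately show ?thesis using openin_subset_trans sub[OF that] by blast
    qed
    have cont_I: "continuous_on S F'" if "S \<in> ?I" for S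
      using that cont_O cont_W by blast
    have "continuous_map (top_of_set ?O') euclidean F'"
    proof (rule pasting_lemma[where f = "\<lambda>_. F'", OF op])
      fix S assume S: "S \<in> ?I"
      have "?O' \<inter> S = S" using sub[OF S] by blast
      then show "continuous_map (subtopology (top_of_set ?O') S) euclidean F'"
        using cont_I[OF S] by (metis continuous_map_iff_continuous subtopology_subtopology)
    next
      fix x assume "x \<in> topspace (top_of_set ?O')"
      then have x: "x \<in> ?O'" by simp
      show "\<exists>S. S \<in> ?I \<and> x \<in> S \<and> F' x = F' x"
      proof (cases "x \<in> ?O")
        case False
        then obtain g where g: "g \<in> carrier G" "0 < b (\<phi> g x)" using x by blast
        have "\<beta> x \<le> 0" using False x by auto
        then have "x \<in> ?W g" using g x by auto
        then show ?thesis using g by blast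
      qed blast
    qed simp_all
    then show ?thesis by simp
  qed
  then show ?thesis unfolding equivariant_map_def using F'_Z F'_equi by blast
qed

text \<open>
  By compactness each nontrivial group element moves all points by some \<open>e > 0\<close>, so balls of radius
  \<open>e / 2\<close> are disjoint from their translates.  The map is built tube by tube over a finite cover,
  starting from the empty map.
\<close>
lemma equivariant_map_exists:
  assumes "compact X" and free: "\<And>g x. \<lbrakk>g \<in> carrier G; x \<in> X; \<phi> g x = x\<rbrakk> \<Longrightarrow> g = \<one>"
  shows "\<exists>F. equivariant_map G \<phi> \<psi> X Z F"
proof -
  have "\<exists>e>0. \<forall>g\<in>carrier G - {\<one>}. \<forall>x\<in>X. e \<le> dist (\<phi> g x) x"
  proof -
    have "\<exists>e>0. \<forall>x\<in>X. e \<le> dist (\<phi> g x) x" if g: "g \<in> carrier G - {\<one>}" for g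
    proof (cases "X = {}")
      case True
      then show ?thesis by (auto intro: exI[of _ 1])
    next
      case False
      have "continuous_on X (\<lambda>x. dist (\<phi> g x) x)"
        using g by (intro continuous_intros X.act_cont) auto
      then obtain x where x: "x \<in> X" "\<forall>y\<in>X. dist (\<phi> g x) x \<le> dist (\<phi> g y) y"
        using continuous_attains_inf[OF assms(1) False] by blast
      moreover have "0 < dist (\<phi> g x) x" using free[of g x] g x by auto
      ultimately show ?thesis by blast
    qed
    then obtain e where e: "\<And>g. g \<in> carrier G - {\<one>} \<Longrightarrow> 0 < e g"
      "\<And>g x. g \<in> carrier G - {\<one>} \<Longrightarrow> x \<in> X \<Longrightarrow> e g \<le> dist (\<phi> g x) x" by metis
    let ?E = "insert 1 (e ` (carrier G - {\<one>}))"
    have "finite ?E" using finite_group by auto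
    then have "0 < Min ?E" "\<forall>g\<in>carrier G - {\<one>}. Min ?E \<le> e g" using e by auto
    then show ?thesis using e(2) by (meson order_trans)
  qed
  then obtain e where e: "0 < e" "\<And>g x. g \<in> carrier G \<Longrightarrow> g \<noteq> \<one> \<Longrightarrow> x \<in> X \<Longrightarrow> e \<le> dist (\<phi> g x) x"
    by blast
  define b where "b c x = max 0 (e / 2 - dist x c)" for c x :: 'a
  define \<beta> where "\<beta> C x = (\<Sum>c\<in>C. \<Sum>g\<in>carrier G. b c (\<phi> g x))" for C x
  have b_cont: "continuous_on S (b c)" for c S unfolding b_def by (intro continuous_intros)
  have b_nn: "0 \<le> b c x" for c x by (simp add: b_def)
  have b_free: "g = \<one>" if "g \<in> carrier G" "x \<in> X" "0 < b c x" "0 < b c (\<phi> g x)" for g x c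
  proof (rule ccontr)
    assume "g \<noteq> \<one>"
    then have "e \<le> dist (\<phi> g x) x" using e(2) that by blast
    also have "\<dots> \<le> dist (\<phi> g x) c + dist x c" by (rule dist_triangle2)
    also have "\<dots> < e" using that(3,4) by (auto simp: b_def max_def split: if_splits)
    finally show False by simp
  qed
  have \<beta>_cont: "continuous_on X (\<beta> C)" for C
    unfolding \<beta>_def
    by (intro continuous_intros continuous_on_compose2[OF b_cont X.act_cont]) auto
  have \<beta>_nn: "0 \<le> \<beta> C x" for C x unfolding \<beta>_def by (intro sum_nonneg b_nn)
  have \<beta>_inv: "\<beta> C (\<phi> k x) = \<beta> C x" if k: "k \<in> carrier G" and x: "x \<in> X" for C k x
    unfolding \<beta>_def
  proof (rule sum.cong[OF refl])
    fix c
    have "(\<Sum>g\<in>carrier G. b c (\<phi> g (\<phi> k x))) = (\<Sum>g\<in>carrier G. b c (\<phi> (g \<otimes> k) x))"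
      using k x by (intro sum.cong) (auto simp: X.act_mult)
    also have "\<dots> = (\<Sum>g\<in>carrier G. b c (\<phi> g x))"
    proof (rule sum.reindex_bij_witness[of _ "\<lambda>g. g \<otimes> inv k" "\<lambda>g. g \<otimes> k"])
    qed (use k in \<open>auto simp: X.m_assoc\<close>)
    finally show "(\<Sum>g\<in>carrier G. b c (\<phi> g (\<phi> k x))) = (\<Sum>g\<in>carrier G. b c (\<phi> g x))" .
  qed
  have step: "\<exists>F. equivariant_map G \<phi> \<psi> {x \<in> X. 0 < \<beta> C x} Z F" if "finite C" for C
    using that
  proof (induction C)
    case empty
    show ?case by (auto simp: equivariant_map_def \<beta>_def)
  next
    case (insert c C)
    then obtain F where F: "equivariant_map G \<phi> \<psi> {x \<in> X. 0 < \<beta> C x} Z F" by blast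
    have "{x \<in> X. 0 < \<beta> C x \<or> (\<exists>g\<in>carrier G. 0 < b c (\<phi> g x))} = {x \<in> X. 0 < \<beta> (insert c C) x}"
    proof -
      have "0 < \<beta> (insert c C) x \<longleftrightarrow> 0 < \<beta> C x \<or> (\<exists>g\<in>carrier G. 0 < b c (\<phi> g x))" for x
      proof -
        have eq: "\<beta> (insert c C) x = (\<Sum>g\<in>carrier G. b c (\<phi> g x)) + \<beta> C x"
          using insert by (simp add: \<beta>_def)
        have "0 < (\<Sum>g\<in>carrier G. b c (\<phi> g x)) \<longleftrightarrow> (\<exists>g\<in>carrier G. 0 < b c (\<phi> g x))"
          using sum_nonneg_eq_0_iff[OF finite_group, of "\<lambda>g. b c (\<phi> g x)"]
            sum_nonneg[of "carrier G" "\<lambda>g. b c (\<phi> g x)"] b_nn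
          by (metis less_le)
        moreover have "0 \<le> (\<Sum>g\<in>carrier G. b c (\<phi> g x))" by (intro sum_nonneg b_nn)
        ultimately show ?thesis using eq \<beta>_nn[of C x] by linarith
      qed
      then show ?thesis by auto
    qed
    then show ?case
      using extend_over_tube[of "\<beta> C" "b c", OF \<beta>_cont \<beta>_nn \<beta>_inv b_cont b_nn b_free F] by simp
  qed
  obtain C where C: "finite C" "C \<subseteq> X" "X \<subseteq> (\<Union>c\<in>C. ball c (e / 2))"
  proof -
    have sub: "X \<subseteq> (\<Union>c\<in>X. ball c (e / 2))" using e by auto
    have "\<exists>C\<subseteq>X. finite C \<and> X \<subseteq> (\<Union>c\<in>C. ball c (e / 2))"
      by (rule compactE_image[OF assms(1) open_ball sub]) blast
    then show thesis using that by blast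
  qed
  have "0 < \<beta> C x" if "x \<in> X" for x
  proof -
    obtain c where c: "c \<in> C" "dist c x < e / 2" using C(3) \<open>x \<in> X\<close> by auto
    have "0 < b c (\<phi> \<one> x)" using c X.act_one[OF that] by (simp add: b_def dist_commute)
    also have "\<dots> \<le> (\<Sum>g\<in>carrier G. b c (\<phi> g x))"
      using member_le_sum[of \<one> "carrier G" "\<lambda>g. b c (\<phi> g x)"] b_nn finite_group by auto
    also have "\<dots> \<le> \<beta> C x" unfolding \<beta>_def
      by (rule member_le_sum[of c C "\<lambda>c. \<Sum>g\<in>carrier G. b c (\<phi> g x)"]) (auto intro: sum_nonneg b_nn c C)
    finally show ?thesis .
  qed
  then have "{x \<in> X. 0 < \<beta> C x} = X" by auto
  then show ?thesis using step[OF C(1)] by simp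
qed

end

section \<open>Maps twisted along complex lines\<close>

lemma homotopic_canonI:
  fixes h :: "real \<times> 'a::topological_space \<Rightarrow> 'b::topological_space"
  assumes "continuous_on ({0..1} \<times> S) h" "h \<in> {0..1} \<times> S \<rightarrow> T"
    and "\<And>x. x \<in> S \<Longrightarrow> h (0, x) = f x" "\<And>x. x \<in> S \<Longrightarrow> h (1, x) = g x"
  shows "homotopic_with_canon (\<lambda>_. True) S T f g"
proof -
  have "homotopic_with_canon (\<lambda>_. True) S T (\<lambda>x. h (0, x)) (\<lambda>x. h (1, x))"
    unfolding homotopic_with_def
    by (rule exI[of _ h]) (use assms(1,2) in \<open>auto simp: prod_topology_subtopology_eu\<close>)
  then show ?thesis by (rule homotopic_with_eq) (use assms in auto)
qed

definition herm :: "complex^'n \<Rightarrow> complex^'n \<Rightarrow> complex" where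
  "herm y u = (\<Sum>i\<in>UNIV. y $ i * cnj (u $ i))"

lemma herm_add_left: "herm (x + y) u = herm x u + herm y u"
  by (simp add: herm_def algebra_simps sum.distrib)

lemma herm_diff_left: "herm (x - y) u = herm x u - herm y u"
  by (simp add: herm_def algebra_simps sum_subtractf)

lemma herm_scale_left: "herm (c *s y) u = c * herm y u"
  by (simp add: herm_def sum_distrib_left mult.assoc)

lemma herm_scale_right: "herm y (c *s u) = cnj c * herm y u"
  by (simp add: herm_def sum_distrib_left mult.left_commute)

lemma Re_herm: "Re (herm y u) = inner y u"
  by (simp add: herm_def inner_vec_def inner_complex_def)

lemma herm_self: "herm u u = of_real ((norm u)\<^sup>2)"
proof -
  have "norm u ^ 2 = (\<Sum>i\<in>UNIV. (cmod (u $ i))\<^sup>2)"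
    by (simp add: norm_vec_def L2_set_def sum_nonneg)
  then show ?thesis by (simp add: herm_def flip: complex_norm_square)
qed

lemma norm_scale: "norm (c *s u) = cmod c * norm (u :: complex^'n)"
proof -
  have "cnj c * c = of_real ((cmod c)\<^sup>2)" by (metis complex_norm_square mult.commute)
  then have "of_real ((norm (c *s u))\<^sup>2) = (of_real ((cmod c * norm u)\<^sup>2) :: complex)"
    unfolding herm_self[symmetric] herm_scale_left herm_scale_right
    by (simp add: herm_self power_mult_distrib flip: mult.assoc)
  then have "(norm (c *s u))\<^sup>2 = (cmod c * norm u)\<^sup>2" unfolding of_real_eq_iff .
  then show ?thesis by (simp add: power2_eq_iff_nonneg)
qed

lemma continuous_on_herm [continuous_intros]:
  "\<lbrakk>continuous_on S f; continuous_on S g\<rbrakk> \<Longrightarrow> continuous_on S (\<lambda>x. herm (f x) (g x))"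
  unfolding herm_def by (intro continuous_intros)

lemma continuous_on_scale [continuous_intros]:
  fixes f :: "'a::topological_space \<Rightarrow> complex^'n"
  shows "\<lbrakk>continuous_on S c; continuous_on S f\<rbrakk> \<Longrightarrow> continuous_on S (\<lambda>x. c x *s f x)"
  unfolding vector_scalar_mult_def by (intro continuous_intros)

definition bump :: "real \<Rightarrow> complex \<Rightarrow> real" where
  "bump c z = max 0 (Re z - c) / (1 - c)"

text \<open>
  For \<open>0 \<le> c < 1\<close>, \<open>wind c\<close> is on the unit circle an explicit nowhere vanishing function of
  winding number one that differs from \<open>1\<close> only on the arc \<open>Re z > c\<close>; at \<open>z = 1\<close> it takes the value \<open>-1\<close>.
\<close>
definition wind :: "real \<Rightarrow> complex \<Rightarrow> complex" where
  "wind c z = Complex (1 - 2 * bump c z) (- (bump c z * Im z))"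

text \<open>
  A power with winding number \<open>a - b\<close>.  Conjugates take the place of negative powers because \<open>wind c\<close>
  has zeros inside the unit disc, where a negative power would not be continuous.
\<close>
definition wind_power :: "nat \<Rightarrow> nat \<Rightarrow> complex \<Rightarrow> complex" where
  "wind_power a b w = w ^ a * cnj w ^ b"

lemma continuous_on_wind [continuous_intros]:
  "continuous_on S f \<Longrightarrow> continuous_on S (\<lambda>x. wind c (f x))"
  unfolding wind_def bump_def Complex_eq divide_inverse by (intro continuous_intros)

lemma continuous_on_wind_power [continuous_intros]:
  "continuous_on S f \<Longrightarrow> continuous_on S (\<lambda>x. wind_power a b (f x))"
  unfolding wind_power_def by (intro continuous_intros)

lemma wind_eq_1: "Re z \<le> c \<Longrightarrow> wind c z = 1"
  by (simp add: wind_def bump_def max_def complex_eq_iff)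

lemma wind_power_1 [simp]: "wind_power a b 1 = 1"
  by (simp add: wind_power_def)

lemma wind_power_eq_0: "wind_power a b w = 0 \<Longrightarrow> w = 0"
  by (auto simp: wind_power_def split: if_splits)

text \<open>
  The values \<open>wind c z\<close> and \<open>-z\<close> are never opposite on the unit circle: off the real axis their
  imaginary parts do not have opposite signs, and at \<open>1\<close> and \<open>-1\<close> the two functions agree.  Hence
  \<open>wind c\<close> is homotopic to \<open>z \<mapsto> -z\<close>, which explains its winding number.
\<close>
lemma wind_path_nonzero:
  assumes c: "0 \<le> c" "c < 1" and z: "cmod z = 1" and t: "0 \<le> t" "t \<le> 1"
  shows "(1 - of_real t) * wind c z - of_real t * z \<noteq> 0"
proof
  let ?k = "bump c z"
  assume "(1 - of_real t) * wind c z - of_real t * z = 0"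
  then have re: "(1 - t) * (1 - 2 * ?k) = t * Re z" and im: "((1 - t) * ?k + t) * Im z = 0"
    by (simp_all add: complex_eq_iff wind_def algebra_simps)
  have k: "0 \<le> ?k" using c by (simp add: bump_def)
  show False
  proof (cases "Im z = 0")
    case True
    then have "\<bar>Re z\<bar> = 1" using z by (simp add: cmod_def)
    then consider "Re z = 1" | "Re z = -1" by linarith
    then show False
    proof cases
      case 1
      then have "?k = 1" using c by (simp add: bump_def)
      then show False using re 1 by simp
    next
      case 2
      then have "?k = 0" using c by (simp add: bump_def)
      then show False using re 2 by simp
    qed
  next
    case False
    then have eq: "(1 - t) * ?k + t = 0" using im by simp
    moreover have "0 \<le> (1 - t) * ?k" using k t by simp
    ultimately have "t = 0" using t by linarith
    then have "?k = 0" using eq by simp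
    then show False using re \<open>t = 0\<close> by simp
  qed
qed

lemma wind_nonzero: "\<lbrakk>0 \<le> c; c < 1; cmod z = 1\<rbrakk> \<Longrightarrow> wind c z \<noteq> 0"
  using wind_path_nonzero[of c z 0] by simp

text \<open>
  The identity, modified near the rays through the unit vectors \<open>u j\<close>.  There the
  displacement is a multiple of \<open>u j\<close>, and on the complex line of \<open>u j\<close> the map is
  \<open>z \<mapsto> z * wind_power (a j) (b j) (wind c z)\<close>.  For rays that are far enough apart the degree
  on the sphere is \<open>1\<close> plus the sum of the numbers \<open>a j - b j\<close>.
\<close>
definition twist :: "real \<Rightarrow> 'j set \<Rightarrow> ('j \<Rightarrow> nat) \<Rightarrow> ('j \<Rightarrow> nat) \<Rightarrow> ('j \<Rightarrow> complex^'n) \<Rightarrow> complex^'n \<Rightarrow> complex^'n" where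
  "twist c J a b u y = y + (\<Sum>j\<in>J. (herm y (u j) * (wind_power (a j) (b j) (wind c (herm y (u j))) - 1)) *s u j)"

text \<open>
  The bound makes the spherical caps \<open>Re (herm y (u j)) > c\<close>, which lie within distance
  \<open>sqrt (2 - 2 * c)\<close> of \<open>u j\<close>, pairwise disjoint.
\<close>
definition separated :: "real \<Rightarrow> 'j set \<Rightarrow> ('j \<Rightarrow> complex^'n) \<Rightarrow> bool" where
  "separated c J u \<longleftrightarrow> (\<forall>j\<in>J. norm (u j) = 1) \<and>
     (\<forall>i\<in>J. \<forall>j\<in>J. i \<noteq> j \<longrightarrow> 8 * (1 - c) \<le> (norm (u i - u j))\<^sup>2)"

lemma separated_unique:
  assumes sep: "separated c J u" and y: "norm y = 1" and ij: "i \<in> J" "j \<in> J"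
    and "wind c (herm y (u i)) \<noteq> 1" "wind c (herm y (u j)) \<noteq> 1"
  shows "i = j"
proof (rule ccontr)
  assume "i \<noteq> j"
  have near: "(norm (y - u k))\<^sup>2 < 2 * (1 - c)" if "k \<in> J" "wind c (herm y (u k)) \<noteq> 1" for k
  proof -
    have "norm (u k) = 1" using sep that by (simp add: separated_def)
    then have "(norm (y - u k))\<^sup>2 = 2 - 2 * inner y (u k)"
      using y by (simp add: power2_norm_eq_inner inner_diff inner_commute norm_eq_1)
    moreover have "c < inner y (u k)"
      using that(2) wind_eq_1[of "herm y (u k)" c] by (auto simp: Re_herm not_le[symmetric])
    ultimately show ?thesis by simp
  qed
  have "norm (u i - u j) \<le> norm (y - u i) + norm (y - u j)"
    using norm_triangle_ineq4[of "y - u j" "y - u i"] by simp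
  then have "(norm (u i - u j))\<^sup>2 \<le> (norm (y - u i) + norm (y - u j))\<^sup>2"
    by (simp add: power_mono)
  also have "\<dots> \<le> 2 * (norm (y - u i))\<^sup>2 + 2 * (norm (y - u j))\<^sup>2"
    using sum_squares_bound[of "norm (y - u i)" "norm (y - u j)"] by (simp add: power2_sum)
  also have "\<dots> < 8 * (1 - c)" using near[OF ij(1) assms(5)] near[OF ij(2) assms(6)] by simp
  finally show False using sep ij \<open>i \<noteq> j\<close> by (auto simp: separated_def not_less[symmetric])
qed

text \<open>
  At most one cap contains \<open>y\<close>, and there the displacement is parallel to \<open>u j\<close>.  So only
  points of the complex line of \<open>u j\<close> could be sent to zero, and on that line the factor by which the
  coordinate is multiplied does not vanish.
\<close>
lemma twist_nonzero:
  assumes c: "0 \<le> c" "c < 1" and J: "finite J" and sep: "separated c J u" and y: "norm y = 1"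
  shows "twist c J a b u y \<noteq> 0"
proof (cases "\<forall>j\<in>J. wind c (herm y (u j)) = 1")
  case True
  then show ?thesis using y by (auto simp: twist_def)
next
  case False
  then obtain j where j: "j \<in> J" "wind c (herm y (u j)) \<noteq> 1" by blast
  let ?z = "herm y (u j)" and ?W = "wind_power (a j) (b j) (wind c (herm y (u j)))"
  have "wind c (herm y (u i)) = 1" if "i \<in> J - {j}" for i
    using separated_unique[OF sep y, of i j] that j by auto
  then have tw: "twist c J a b u y = y + (?z * (?W - 1)) *s u j"
    by (simp add: twist_def sum.remove[OF J j(1)])
  have u: "norm (u j) = 1" using sep j by (simp add: separated_def)
  show ?thesis
  proof
    assume "twist c J a b u y = 0"
    then have "y = - ((?z * (?W - 1)) *s u j)" unfolding tw by (simp add: eq_neg_iff_add_eq_0)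
    then have yeq: "y = (?z * (1 - ?W)) *s u j" 
      by (simp add: right_diff_distrib vector_sub_rdistrib)
    have "herm (k *s u j) (u j) = k" for k
      using u by (simp add: herm_scale_left herm_self)
    then have "?z = ?z * (1 - ?W)"
      using arg_cong[OF yeq, of "\<lambda>v. herm v (u j)"] by (rule trans[rotated])
    moreover have "?z \<noteq> 0" using yeq y by auto
    ultimately have W0: "?W = 0" by (simp add: algebra_simps)
    then have "cmod ?z = 1" using arg_cong[OF yeq, of norm] y u by (simp add: norm_scale)
    then show False using wind_power_eq_0[OF W0] wind_nonzero[OF c] by blast
  qed
qed

lemma twist_in_subspace:
  assumes "vec.subspace V" "y \<in> V" "\<And>j. j \<in> J \<Longrightarrow> u j \<in> V"
  shows "twist c J a b u y \<in> V"
  unfolding twist_def using assms by (intro vec.subspace_add vec.subspace_sum vec.subspace_scale)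

text \<open>
  None of the twists along the way has a zero, so following the moving rays is a homotopy.  It ignores
  the symmetry, and so the rays can leave their symmetric position.
\<close>
lemma homotopic_twist:
  assumes c: "0 \<le> c" "c < 1" and J: "finite J" and V: "vec.subspace V"
    and u_cont: "\<And>j. j \<in> J \<Longrightarrow> continuous_on {0..1} (\<lambda>t. u t j)"
    and u_V: "\<And>j t. \<lbrakk>j \<in> J; t \<in> {0..1}\<rbrakk> \<Longrightarrow> u t j \<in> V"
    and sep: "\<And>t. t \<in> {0..1} \<Longrightarrow> separated c J (u t)"
  shows "homotopic_with_canon (\<lambda>_. True) (V \<inter> sphere 0 1) (V - {0})
           (twist c J a b (u 0)) (twist c J a b (u (1::real)))"
proof (rule homotopic_canonI[where h = "\<lambda>(t, y). twist c J a b (u t) y"])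
  have [continuous_intros]: "continuous_on ({0..1} \<times> (V \<inter> sphere 0 1)) (\<lambda>p. u (fst p) j)" if "j \<in> J" for j
    by (rule continuous_on_compose2[OF u_cont[OF that]]) (auto intro!: continuous_intros)
  show "continuous_on ({0..1} \<times> (V \<inter> sphere 0 1)) (\<lambda>(t, y). twist c J a b (u t) y)"
    unfolding twist_def case_prod_unfold by (intro continuous_intros)
  show "(\<lambda>(t, y). twist c J a b (u t) y) \<in> {0..1} \<times> (V \<inter> sphere 0 1) \<rightarrow> V - {0}"
  proof clarify
    fix t :: real and y assume t: "t \<in> {0..1}" and y: "y \<in> V" "y \<in> sphere 0 1"
    have "twist c J a b (u t) y \<in> V" by (rule twist_in_subspace[OF V y(1) u_V[OF _ t]])
    moreover have "twist c J a b (u t) y \<noteq> 0" using twist_nonzero[OF c J sep[OF t]] y by simp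
    ultimately show "twist c J a b (u t) y \<in> V - {0}" by blast
  qed
qed auto

text \<open>
  When all rays lie in the complex line of \<open>q\<close>, the sum of the displacements collapses to a
  product: at most one factor differs from \<open>1\<close>, so \<open>1 + (\<Sum>j\<in>J. W j - 1) = (\<Prod>j\<in>J. W j)\<close>.
\<close>
lemma twist_collinear:
  assumes J: "finite J" and sep: "separated c J (\<lambda>j. \<mu> j *s q)" and q: "norm q = 1" and y: "norm y = 1"
  shows "twist c J a b (\<lambda>j. \<mu> j *s q) y = y - herm y q *s q +
           (herm y q * (\<Prod>j\<in>J. wind_power (a j) (b j) (wind c (cnj (\<mu> j) * herm y q)))) *s q"
proof -
  let ?z = "herm y q" and ?W = "\<lambda>j. wind_power (a j) (b j) (wind c (cnj (\<mu> j) * herm y q))"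
  have \<mu>: "cnj (\<mu> j) * \<mu> j = 1" if "j \<in> J" for j
  proof -
    have "cmod (\<mu> j) = 1" using sep that q by (simp add: separated_def norm_scale)
    then show ?thesis by (metis complex_norm_square mult.commute of_real_1 power_one)
  qed
  have "1 + (\<Sum>j\<in>J. ?W j - 1) = (\<Prod>j\<in>J. ?W j)"
  proof (cases "\<forall>j\<in>J. ?W j = 1")
    case False
    then obtain j where j: "j \<in> J" "?W j \<noteq> 1" by blast
    then have "wind c (cnj (\<mu> j) * herm y q) \<noteq> 1" by auto
    then have "wind c (cnj (\<mu> i) * herm y q) = 1" if "i \<in> J - {j}" for i
      using separated_unique[OF sep y, of i j] that j by (auto simp: herm_scale_right)
    then have "?W i = 1" if "i \<in> J - {j}" for i using that by simp
    then show ?thesis by (simp add: sum.remove[OF J j(1)] prod.remove[OF J j(1)])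
  qed simp
  then have prod: "(\<Prod>j\<in>J. ?W j) = 1 + (\<Sum>j\<in>J. ?W j - 1)" by simp
  have "twist c J a b (\<lambda>j. \<mu> j *s q) y = y + (\<Sum>j\<in>J. (?z * (?W j - 1)) *s q)"
    unfolding twist_def herm_scale_right
  proof (intro arg_cong[where f = "\<lambda>v. y + v"] sum.cong refl)
    fix j assume "j \<in> J"
    then show "(cnj (\<mu> j) * ?z * (?W j - 1)) *s (\<mu> j *s q) = (?z * (?W j - 1)) *s q"
      using \<mu>[of j] by (simp add: vector_smult_assoc mult_ac)
  qed
  also have "(\<Sum>j\<in>J. (?z * (?W j - 1)) *s q) = (?z * (\<Sum>j\<in>J. ?W j - 1)) *s q"
    by (simp add: vec.scale_sum_left sum_distrib_left)
  also have "y + \<dots> = y - ?z *s q + (?z * (\<Prod>j\<in>J. ?W j)) *s q"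
    unfolding prod by (simp add: ring_distribs vector_sadd_rdistrib)
  finally show ?thesis .
qed

text \<open>
  Replacing the coordinate along \<open>q\<close> by \<open>\<alpha>\<close> cannot produce zero unless the component orthogonal to \<open>q\<close>
  vanishes, so only the values of \<open>\<alpha>\<close> on the complex line of \<open>q\<close> are constrained.
\<close>
lemma line_map_nonzero:
  assumes q: "norm q = 1" and y: "norm y = 1" and nz: "cmod (herm y q) = 1 \<Longrightarrow> \<alpha> \<noteq> 0"
  shows "y - herm y q *s q + \<alpha> *s q \<noteq> 0"
proof
  assume 0: "y - herm y q *s q + \<alpha> *s q = 0"
  have "\<alpha> = herm (y - herm y q *s q + \<alpha> *s q) q"
    using q by (simp add: herm_add_left herm_diff_left herm_scale_left herm_self)
  also have "\<dots> = 0" unfolding 0 by (simp add: herm_def)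
  finally have \<alpha>: "\<alpha> = 0" .
  then have "y = herm y q *s q" using 0 by simp
  then have "cmod (herm y q) = 1" using q y by (metis mult.right_neutral norm_scale)
  then show False using nz \<alpha> by blast
qed

text \<open>
  Deforming each \<open>wind c z\<close> into \<open>-z\<close> turns the coordinate along \<open>q\<close> into a constant multiple of
  \<open>z * z ^ A * cnj z ^ B\<close>, where \<open>A\<close> and \<open>B\<close> are the sums of the \<open>a j\<close> and \<open>b j\<close>.  For \<open>A + 1 = B\<close>
  this is a constant times \<open>\<bar>z\<bar> ^ (2 * B)\<close>, which keeps its direction, and the remaining map contracts
  along segments.
\<close>
lemma twist_collinear_null_homotopic:
  assumes c: "0 \<le> c" "c < 1" and J: "finite J" and V: "vec.subspace V"
    and sep: "separated c J (\<lambda>j. \<mu> j *s q)" and q: "norm q = 1" "q \<in> V"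
    and deg: "(\<Sum>j\<in>J. a j) + 1 = (\<Sum>j\<in>J. b j)"
  shows "\<exists>p. homotopic_with_canon (\<lambda>_. True) (V \<inter> sphere 0 1) (V - {0})
           (twist c J a b (\<lambda>j. \<mu> j *s q)) (\<lambda>_. p)"
proof -
  let ?S = "V \<inter> sphere 0 1" and ?T = "V - {0}"
  let ?L = "\<lambda>\<alpha> y. y - herm y q *s q + \<alpha> *s q"
  define B where "B = (\<Sum>j\<in>J. b j)"
  define C where "C = (\<Prod>j\<in>J. wind_power (a j) (b j) (- cnj (\<mu> j)))"
  have \<mu>: "cmod (\<mu> j) = 1" if "j \<in> J" for j
    using sep that q by (simp add: separated_def norm_scale)
  have "C \<noteq> 0" unfolding C_def using J \<mu> wind_power_eq_0 by fastforce
  have L_V: "?L \<alpha> y \<in> V" if "y \<in> V" for \<alpha> y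
    using that q V by (intro vec.subspace_add vec.subspace_diff vec.subspace_scale)
  define \<alpha> where "\<alpha> t y = herm y q * (\<Prod>j\<in>J. wind_power (a j) (b j)
    ((1 - of_real t) * wind c (cnj (\<mu> j) * herm y q) - of_real t * (cnj (\<mu> j) * herm y q)))"
    for t :: real and y
  have \<alpha>1: "\<alpha> 1 y = C * of_real ((cmod (herm y q))\<^sup>2 ^ B)" for y
  proof -
    let ?z = "herm y q"
    have "\<alpha> 1 y = ?z * (\<Prod>j\<in>J. wind_power (a j) (b j) (- cnj (\<mu> j)) * (?z ^ a j * cnj ?z ^ b j))"
    proof -
      have "wind_power (a j) (b j) (((1 - of_real 1) * w) - of_real 1 * (cnj (\<mu> j) * ?z)) =
          wind_power (a j) (b j) (- cnj (\<mu> j)) * (?z ^ a j * cnj ?z ^ b j)" for j w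
      proof -
        have "((1 - of_real 1) * w) - of_real 1 * (cnj (\<mu> j) * ?z) = - cnj (\<mu> j) * ?z" by simp
        then show ?thesis
          unfolding wind_power_def by (simp only: power_mult_distrib complex_cnj_mult mult_ac)
      qed
      then show ?thesis unfolding \<alpha>_def by (simp only:)
    qed
    also have "\<dots> = C * (?z ^ (sum a J + 1) * cnj ?z ^ B)"
      by (simp add: prod.distrib C_def B_def power_sum)
    also have "\<dots> = C * (?z * cnj ?z) ^ B" unfolding deg B_def[symmetric] power_mult_distrib ..
    finally show ?thesis by (simp add: complex_norm_square[symmetric])
  qed
  have 1: "homotopic_with_canon (\<lambda>_. True) ?S ?T (twist c J a b (\<lambda>j. \<mu> j *s q)) (\<lambda>y. ?L (\<alpha> 1 y) y)"
  proof (rule homotopic_canonI[where h = "\<lambda>(t, y). ?L (\<alpha> t y) y"])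
    show "continuous_on ({0..1} \<times> ?S) (\<lambda>(t, y). ?L (\<alpha> t y) y)"
      unfolding \<alpha>_def case_prod_unfold by (intro continuous_intros)
    show "(\<lambda>(t, y). ?L (\<alpha> t y) y) \<in> {0..1} \<times> ?S \<rightarrow> ?T"
    proof clarify
      fix t :: real and y assume "t \<in> {0..1}" "y \<in> V" "y \<in> sphere 0 1"
      then have t: "0 \<le> t" "t \<le> 1" and y: "y \<in> V" "norm y = 1" by auto
      have "\<alpha> t y \<noteq> 0" if z: "cmod (herm y q) = 1"
      proof -
        have "herm y q \<noteq> 0" using z by auto
        moreover have "cmod (cnj (\<mu> j) * herm y q) = 1" if "j \<in> J" for j
          using \<mu>[OF that] z by (simp add: norm_mult)
        ultimately show ?thesis
          unfolding \<alpha>_def using wind_path_nonzero[OF c _ t] wind_power_eq_0 J by fastforce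
      qed
      then show "?L (\<alpha> t y) y \<in> ?T"
        using L_V[OF y(1)] line_map_nonzero[OF q(1) y(2)] by blast
    qed
  qed (use twist_collinear[OF J sep q(1)] in \<open>auto simp: \<alpha>_def\<close>)
  have 2: "homotopic_with_canon (\<lambda>_. True) ?S ?T (\<lambda>y. ?L (\<alpha> 1 y) y) (\<lambda>_. C *s q)"
  proof (rule homotopic_canonI[where h = "\<lambda>(t, y). (1 - of_real t) *s (y - herm y q *s q) +
      (C * of_real ((1 - t) * (cmod (herm y q))\<^sup>2 ^ B + t)) *s q"])
    let ?h = "\<lambda>(t, y). (1 - of_real t) *s (y - herm y q *s q) +
      (C * of_real ((1 - t) * (cmod (herm y q))\<^sup>2 ^ B + t)) *s q"
    show "continuous_on ({0..1} \<times> ?S) ?h"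
      unfolding case_prod_unfold by (intro continuous_intros)
    show "?h \<in> {0..1} \<times> ?S \<rightarrow> ?T"
    proof clarify
      fix t :: real and y assume "t \<in> {0..1}" "y \<in> V" "y \<in> sphere 0 1"
      then have t: "0 \<le> t" "t \<le> 1" and y: "y \<in> V" "norm y = 1" by auto
      let ?r = "(1 - t) * (cmod (herm y q))\<^sup>2 ^ B + t"
      let ?v = "(1 - of_real t) *s (y - herm y q *s q) + (C * of_real ?r) *s q"
      have "?v \<in> V"
        using y q V by (intro vec.subspace_add vec.subspace_diff vec.subspace_scale)
      moreover have "?v \<noteq> 0"
      proof
        assume 0: "?v = 0"
        have "C * of_real ?r = herm ?v q"
          using q by (simp add: herm_add_left herm_diff_left herm_scale_left herm_self left_diff_distrib)
        also have "\<dots> = 0" unfolding 0 by (simp add: herm_def)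
        finally have r: "?r = 0" using \<open>C \<noteq> 0\<close> by (simp only: mult_eq_0_iff of_real_eq_0_iff) simp
        moreover have "0 \<le> (1 - t) * (cmod (herm y q))\<^sup>2 ^ B" using t by simp
        ultimately have "t = 0" using t by linarith
        then have "herm y q = 0" using r by (simp split: if_splits)
        then have "?v = y" unfolding r using \<open>t = 0\<close> by simp
        then have "y = 0" using 0 by (rule trans[OF sym])
        then show False using y by simp
      qed
      ultimately show "?v \<in> ?T" by blast
    qed
  qed (simp_all add: \<alpha>1)
  show ?thesis using homotopic_with_trans[OF 1 2] by blast
qed

section \<open>Binomial coefficients without a common divisor\<close>

text \<open>
  If \<open>p ^ a\<close> is the exact power of the prime \<open>p\<close> in \<open>r\<close>, then \<open>p\<close> does not divide \<open>r choose p ^ a\<close>.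
  This is the count in Wielandt's proof of Sylow's theorem; \<open>p ^ a < r\<close> because \<open>r\<close> is not a power of \<open>p\<close>.
\<close>
lemma Gcd_binomials_eq_1:
  fixes r :: nat
  assumes r: "0 < r" and npp: "\<nexists>p k. prime p \<and> r = p ^ k"
  shows "Gcd ((\<lambda>k. r choose k) ` {0<..<r}) = 1"
proof (rule ccontr)
  assume "Gcd ((\<lambda>k. r choose k) ` {0<..<r}) \<noteq> 1"
  then obtain p where p: "prime p" "p dvd Gcd ((\<lambda>k. r choose k) ` {0<..<r})"
    using prime_factor_nat by blast
  define a where "a = multiplicity p r"
  obtain m where m: "r = p ^ a * m" using multiplicity_dvd[of p r] unfolding a_def by (auto elim: dvdE)
  have m0: "0 < m" using r m by (cases m) auto
  have "\<not> p dvd m"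
  proof
    assume "p dvd m"
    then have "p ^ Suc a dvd r" unfolding m by (simp add: mult_dvd_mono mult.commute)
    then have "Suc a \<le> multiplicity p r"
      using r p(1) by (intro multiplicity_geI) (auto simp: prime_nat_iff)
    then show False by (simp add: a_def)
  qed
  have "m \<noteq> 1" using npp p(1) m by (metis mult.right_neutral)
  then have range: "p ^ a \<in> {0<..<r}" using m m0 p(1) by (simp add: prime_gt_0_nat)
  then have "p dvd r choose p ^ a" using p(2) by (meson Gcd_dvd dvd_trans imageI)
  moreover have "0 < r choose p ^ a" using range by simp
  ultimately have "multiplicity p (r choose p ^ a) \<noteq> 0"
    using p(1) by (metis multiplicity_eq_zero_iff neq0_conv not_prime_unit)
  moreover have "multiplicity p (r choose p ^ a) = multiplicity p m"
    unfolding m by (rule const_p_fac[OF m0 p(1)])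
  ultimately show False using \<open>\<not> p dvd m\<close> by (simp add: not_dvd_imp_multiplicity_0)
qed

lemma bezout_finite_int:
  fixes c :: "'k \<Rightarrow> int"
  assumes "finite K"
  shows "\<exists>x. (\<Sum>k\<in>K. x k * c k) = Gcd (c ` K)"
  using assms
proof induction
  case (insert l K)
  then obtain x where x: "(\<Sum>k\<in>K. x k * c k) = Gcd (c ` K)" by blast
  obtain s t where st: "s * c l + t * Gcd (c ` K) = gcd (c l) (Gcd (c ` K))"
    using bezout_int by blast
  have "(\<Sum>k\<in>insert l K. (if k = l then s else t * x k) * c k) = s * c l + (\<Sum>k\<in>K. t * (x k * c k))"
    using insert by (auto intro!: sum.cong simp: mult.assoc)
  also have "\<dots> = gcd (c l) (Gcd (c ` K))" using x st by (simp flip: sum_distrib_left)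
  finally have "(\<Sum>k\<in>insert l K. (if k = l then s else t * x k) * c k) = Gcd (c ` insert l K)" by simp
  then show ?case by (rule exI[of _ "\<lambda>k. if k = l then s else t * x k"])
qed auto

lemma binomial_combination:
  fixes r :: nat
  assumes "0 < r" "\<nexists>p k. prime p \<and> r = p ^ k"
  shows "\<exists>a b. (\<Sum>k\<in>{0<..<r}. (r choose k) * a k) + 1 = (\<Sum>k\<in>{0<..<r}. (r choose k) * b k)"
proof -
  let ?K = "{0<..<r}" and ?c = "\<lambda>k. int (r choose k)"
  obtain x where "(\<Sum>k\<in>?K. x k * ?c k) = Gcd (?c ` ?K)"
    using bezout_finite_int[of ?K ?c] by auto
  also have "?c ` ?K = int ` (\<lambda>k. r choose k) ` ?K" by (simp add: image_image)
  also have "Gcd \<dots> = 1" using Gcd_binomials_eq_1[OF assms] by (metis Gcd_int_eq of_nat_1)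
  finally have x: "(\<Sum>k\<in>?K. x k * ?c k) = 1" .
  define a b where "a k = nat (- x k)" and "b k = nat (x k)" for k
  have "(\<Sum>k\<in>?K. ?c k * int (b k)) - (\<Sum>k\<in>?K. ?c k * int (a k)) = (\<Sum>k\<in>?K. x k * ?c k)"
    unfolding sum_subtractf[symmetric]
  proof (rule sum.cong[OF refl])
    fix k
    have "int (b k) - int (a k) = x k" by (simp add: a_def b_def)
    then show "?c k * int (b k) - ?c k * int (a k) = x k * ?c k"
      by (metis mult.commute right_diff_distrib)
  qed
  then have "int ((\<Sum>k\<in>?K. (r choose k) * a k) + 1) = int (\<Sum>k\<in>?K. (r choose k) * b k)" by (simp add: x)
  then show ?thesis by (metis of_nat_eq_iff)
qed

lemma sum_proper_subsets_card:
  fixes g :: "nat \<Rightarrow> nat"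
  shows "(\<Sum>A | A \<noteq> {} \<and> A \<noteq> (UNIV :: 'r::finite set). g (card A)) =
           (\<Sum>k\<in>{0<..<CARD('r)}. (CARD('r) choose k) * g k)"
proof -
  let ?J = "{A. A \<noteq> {} \<and> A \<noteq> (UNIV :: 'r set)}"
  have rng: "card A \<in> {0<..<CARD('r)}" if "A \<in> ?J" for A
    using that psubset_card_mono[of UNIV A] by (simp add: card_gt_0_iff psubset_eq)
  have "(\<Sum>A\<in>?J. g (card A)) = (\<Sum>k\<in>{0<..<CARD('r)}. \<Sum>A\<in>{A \<in> ?J. card A = k}. g (card A))"
  proof (rule sum.group[symmetric])
    show "card ` ?J \<subseteq> {0<..<CARD('r)}" using rng by blast
  qed simp_all
  also have "\<dots> = (\<Sum>k\<in>{0<..<CARD('r)}. (CARD('r) choose k) * g k)"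
  proof (rule sum.cong[OF refl])
    fix k assume k: "k \<in> {0<..<CARD('r)}"
    then have "{A \<in> ?J. card A = k} = {A. A \<subseteq> UNIV \<and> card A = k}" by auto
    then have "card {A \<in> ?J. card A = k} = CARD('r) choose k" using n_subsets[of "UNIV :: 'r set" k] by simp
    then show "(\<Sum>A\<in>{A \<in> ?J. card A = k}. g (card A)) = (CARD('r) choose k) * g k" by simp
  qed
  finally show ?thesis .
qed

section \<open>An equivariant null-homotopic self-map of the permutation representation\<close>

definition mean_zero :: "(complex^'r) set" where
  "mean_zero = {y. (\<Sum>i\<in>UNIV. y $ i) = 0}"

lemma subspace_mean_zero: "vec.subspace (mean_zero :: (complex^'r) set)"
  by (simp add: vec.subspace_def mean_zero_def sum.distrib flip: sum_distrib_left)

lemma scaleR_eq_scale: "r *\<^sub>R x = of_real r *s (x :: complex^'n)"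
  by (simp add: vec_eq_iff scaleR_conv_of_real[where 'a = complex])

lemma sgn_scale: "sgn (c *s x) = sgn c *s sgn (x :: complex^'n)"
  by (simp add: sgn_div_norm norm_scale scaleR_eq_scale vector_smult_assoc
      scaleR_conv_of_real[where 'a = complex] divide_simps)

definition permute_coords :: "('r \<Rightarrow> 'r) \<Rightarrow> complex^'r \<Rightarrow> complex^'r" where
  "permute_coords \<sigma> y = (\<chi> i. y $ inv_into UNIV \<sigma> i)"

lemma permute_coords_nth [simp]: "permute_coords \<sigma> y $ i = y $ inv_into UNIV \<sigma> i"
  by (simp add: permute_coords_def)

lemma permute_coords_add: "permute_coords \<sigma> (x + y) = permute_coords \<sigma> x + permute_coords \<sigma> y"
  by (simp add: vec_eq_iff)

lemma permute_coords_scale: "permute_coords \<sigma> (c *s x) = c *s permute_coords \<sigma> x"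
  by (simp add: vec_eq_iff)

lemma permute_coords_sum: "permute_coords \<sigma> (\<Sum>j\<in>J. f j) = (\<Sum>j\<in>J. permute_coords \<sigma> (f j))"
  by (simp add: vec_eq_iff)

lemma sum_permute:
  fixes \<sigma> :: "'r::finite \<Rightarrow> 'r"
  assumes "bij \<sigma>" shows "(\<Sum>i\<in>UNIV. F (inv_into UNIV \<sigma> i)) = (\<Sum>i\<in>UNIV. F i)"
  using sum.reindex_bij_betw[OF bij_imp_bij_inv[OF assms], of F] .

lemma herm_permute:
  "bij \<sigma> \<Longrightarrow> herm (permute_coords \<sigma> x) (permute_coords \<sigma> y) = herm x y"
  using sum_permute[of \<sigma> "\<lambda>i. x $ i * cnj (y $ i)"] by (simp add: herm_def)

lemma norm_permute:
  assumes "bij \<sigma>" shows "norm (permute_coords \<sigma> x) = norm x"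
proof -
  have "of_real ((norm (permute_coords \<sigma> x))\<^sup>2) = (of_real ((norm x)\<^sup>2) :: complex)"
    unfolding herm_self[symmetric] by (rule herm_permute[OF assms])
  then show ?thesis unfolding of_real_eq_iff by (simp add: power2_eq_iff_nonneg)
qed

lemma sgn_permute: "bij \<sigma> \<Longrightarrow> sgn (permute_coords \<sigma> x) = permute_coords \<sigma> (sgn x)"
  by (simp add: sgn_div_norm norm_permute scaleR_eq_scale permute_coords_scale)

lemma permute_coords_mean_zero: "bij \<sigma> \<Longrightarrow> y \<in> mean_zero \<Longrightarrow> permute_coords \<sigma> y \<in> mean_zero"
  using sum_permute[of \<sigma> "\<lambda>i. y $ i"] by (simp add: mean_zero_def)

definition centred_indicator :: "'r::finite set \<Rightarrow> complex^'r" where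
  "centred_indicator A = (\<chi> i. of_bool (i \<in> A) - of_nat (card A) / of_nat CARD('r))"

lemma centred_indicator_mean_zero: "centred_indicator A \<in> mean_zero"
proof -
  have "(\<Sum>i\<in>UNIV. of_bool (i \<in> A)) = (of_nat (card A) :: complex)"
    by (simp add: of_bool_def sum.If_cases)
  then show ?thesis by (simp add: mean_zero_def centred_indicator_def sum_subtractf)
qed

lemma centred_indicator_permute:
  assumes "bij \<sigma>" shows "centred_indicator (\<sigma> ` A) = permute_coords \<sigma> (centred_indicator A)"
proof -
  have "i \<in> \<sigma> ` A \<longleftrightarrow> inv_into UNIV \<sigma> i \<in> A" for i
    using assms by (metis bij_image_Collect_eq bij_inv_eq_iff image_iff)
  moreover have "card (\<sigma> ` A) = card A"
    using assms by (meson bij_is_inj card_image inj_on_subset subset_UNIV)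
  ultimately show ?thesis by (simp add: vec_eq_iff centred_indicator_def)
qed

abbreviation proper_subsets :: "'r set set" where
  "proper_subsets \<equiv> {A. A \<noteq> {} \<and> A \<noteq> UNIV}"

text \<open>
  The path moves the ray of \<open>A\<close> out of its symmetric position into the complex line of \<open>q\<close>; the
  factors \<open>l A\<close> keep the rays of different sets apart at the end.
\<close>
definition slide :: "('r set \<Rightarrow> complex) \<Rightarrow> complex^'r \<Rightarrow> real \<Rightarrow> 'r::finite set \<Rightarrow> complex^'r" where
  "slide l q t A = (1 - of_real t) *s centred_indicator A + (of_real t * l A) *s q"

text \<open>
  The paths of different sets never point in the same direction.  The sets \<open>A\<close> and \<open>B\<close> divide the
  indices into at most four classes, so with five indices two of them lie in the same class.  At
  these the indicators agree, and comparing the coordinates isolates the multiples of \<open>q\<close>, which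
  are distinguished by \<open>l\<close>.  At time \<open>0\<close>, where these multiples vanish, the indicators
  are compared.  The case \<open>c = 0\<close> says that the paths avoid zero.
\<close>
lemma slide_not_parallel:
  fixes A B :: "'r::finite set"
  assumes r: "5 \<le> CARD('r)" and q: "inj (\<lambda>i. q $ i)"
    and l: "inj l" "\<And>A. Re (l A) = 1"
    and A: "A \<in> proper_subsets" and c: "0 \<le> c"
    and eq: "slide l q t A = of_real c *s slide l q t B"
  shows "c \<noteq> 0 \<and> A = B"
proof (cases "t = 0")
  case True
  have ind: "of_bool (i \<in> A) - of_bool (j \<in> A) = c * (of_bool (i \<in> B) - of_bool (j \<in> B))" for i j
  proof -
    have "centred_indicator A = of_real c *s centred_indicator B" using eq True by (simp add: slide_def)
    then have "centred_indicator A $ i - centred_indicator A $ j =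
        of_real c * (centred_indicator B $ i - centred_indicator B $ j)"
      by (simp add: right_diff_distrib)
    then have "of_bool (i \<in> A) - of_bool (j \<in> A) =
        complex_of_real c * (of_bool (i \<in> B) - of_bool (j \<in> B))"
      by (simp add: centred_indicator_def del: of_bool_eq_iff)
    from arg_cong[OF this, of Re] show ?thesis by (auto simp: of_bool_def split: if_splits)
  qed
  have sep: "c \<noteq> 0 \<and> i \<in> B \<and> j \<notin> B" if "i \<in> A" "j \<notin> A" for i j
    using ind[of i j] that c by (cases "i \<in> B"; cases "j \<in> B") auto
  then show ?thesis using A by blast
next
  case False
  have "\<not> inj (\<lambda>i. (i \<in> A, i \<in> B))"
  proof
    assume "inj (\<lambda>i. (i \<in> A, i \<in> B))"
    then have "CARD('r) \<le> CARD(bool \<times> bool)" by (rule card_inj_on_le) auto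
    then show False using r by simp
  qed
  then obtain i j where ij: "i \<noteq> j" "i \<in> A \<longleftrightarrow> j \<in> A" "i \<in> B \<longleftrightarrow> j \<in> B" by (auto simp: inj_def)
  have d: "slide l q t C $ i - slide l q t C $ j = of_real t * (l C * (q $ i - q $ j))"
    if "i \<in> C \<longleftrightarrow> j \<in> C" for C
    using that by (simp add: slide_def centred_indicator_def algebra_simps)
  have "slide l q t A $ i - slide l q t A $ j = of_real c * (slide l q t B $ i - slide l q t B $ j)"
    unfolding eq by (simp add: right_diff_distrib)
  then have "of_real t * ((q $ i - q $ j) * (l A - of_real c * l B)) = 0"
    unfolding d[OF ij(2)] d[OF ij(3)] by (simp add: algebra_simps)
  moreover have "q $ i \<noteq> q $ j" using injD[OF q, of i j] ij(1) by blast
  ultimately have "l A = of_real c * l B" using False by simp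
  then have "c = 1" using l(2)[of A] l(2)[of B] by simp
  then show ?thesis using \<open>l A = _\<close> l(1) by (simp add: inj_def)
qed

lemma slide_mean_zero: "q \<in> mean_zero \<Longrightarrow> slide l q t A \<in> mean_zero"
  unfolding slide_def
  by (intro vec.subspace_add vec.subspace_scale subspace_mean_zero centred_indicator_mean_zero)

lemma continuous_on_slide [continuous_intros]: "continuous_on S (\<lambda>t. slide l q t A)"
  unfolding slide_def by (intro continuous_intros)

text \<open>
  By compactness of the time interval, distinct moving unit vectors keep a positive distance, so a
  single \<open>c\<close> serves for all times.
\<close>
lemma uniformly_separated:
  fixes u :: "real \<Rightarrow> 'j \<Rightarrow> complex^'n"
  assumes J: "finite J" and cont: "\<And>j. j \<in> J \<Longrightarrow> continuous_on {0..1} (\<lambda>t. u t j)"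
    and unit: "\<And>j t. \<lbrakk>j \<in> J; t \<in> {0..1}\<rbrakk> \<Longrightarrow> norm (u t j) = 1"
    and distinct: "\<And>i j t. \<lbrakk>i \<in> J; j \<in> J; t \<in> {0..1}; u t i = u t j\<rbrakk> \<Longrightarrow> i = j"
  shows "\<exists>c. 0 \<le> c \<and> c < 1 \<and> (\<forall>t\<in>{0..1}. separated c J (u t))"
proof -
  let ?gap = "\<lambda>t i j. (norm (u t i - u t j))\<^sup>2"
  have small: "\<forall>\<^sub>F e in at_right 0. \<forall>t\<in>{0..1}. i \<noteq> j \<longrightarrow> e \<le> ?gap t i j"
    if ij: "i \<in> J" "j \<in> J" for i j
  proof (cases "i = j")
    case False
    have gap_cont: "continuous_on {0..1} (\<lambda>t. ?gap t i j)"
      using ij by (intro continuous_intros cont)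
    have "{0..1::real} \<noteq> {}" by simp
    then obtain s where s: "s \<in> {0..1}" "\<forall>t\<in>{0..1}. ?gap s i j \<le> ?gap t i j"
      using continuous_attains_inf[OF compact_Icc _ gap_cont] by blast
    have "u s i \<noteq> u s j" using distinct[OF ij s(1)] False by blast
    then have "0 < ?gap s i j" by simp
    from eventually_at_right_real[OF this] show ?thesis
    proof eventually_elim
      case (elim e)
      then have "e \<le> ?gap s i j" by simp
      then show ?case using s(2) order_trans by blast
    qed
  qed simp
  have "\<forall>\<^sub>F e in at_right 0. \<forall>i\<in>J. \<forall>j\<in>J. \<forall>t\<in>{0..1}. i \<noteq> j \<longrightarrow> e \<le> ?gap t i j"
    by (intro eventually_ball_finite J ballI small)
  moreover have "\<forall>\<^sub>F e in at_right 0. e \<in> {0<..<8 :: real}"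
    by (rule eventually_at_right_real) simp
  ultimately have "\<forall>\<^sub>F e in at_right 0. e \<in> {0<..<8 :: real} \<and>
      (\<forall>i\<in>J. \<forall>j\<in>J. \<forall>t\<in>{0..1}. i \<noteq> j \<longrightarrow> e \<le> ?gap t i j)"
    by eventually_elim blast
  from eventually_happens'[OF trivial_limit_at_right_real this] obtain e where
    e: "e \<in> {0<..<8 :: real}" "\<And>i j t. \<lbrakk>i \<in> J; j \<in> J; t \<in> {0..1}; i \<noteq> j\<rbrakk> \<Longrightarrow> e \<le> ?gap t i j"
    by blast
  have "separated (1 - e / 8) J (u t)" if t: "t \<in> {0..1}" for t
    unfolding separated_def
  proof (intro conjI ballI impI)
    fix i j assume "i \<in> J" "j \<in> J" "i \<noteq> j"
    from e(2)[OF this(1,2) t this(3)] show "8 * (1 - (1 - e / 8)) \<le> ?gap t i j" by simp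
  qed (rule unit[OF _ t])
  moreover have "0 \<le> 1 - e / 8" "1 - e / 8 < 1" using e(1) by simp_all
  ultimately show ?thesis by blast
qed

text \<open>
  The exponents depend on the cardinality only, so a permutation of the coordinates merely reindexes
  the sum over the sets.
\<close>
lemma twist_permute:
  fixes u :: "'r::finite set \<Rightarrow> complex^'r"
  assumes \<sigma>: "bij \<sigma>" and u: "\<And>A. u (\<sigma> ` A) = permute_coords \<sigma> (u A)"
  shows "twist c proper_subsets (a \<circ> card) (b \<circ> card) u (permute_coords \<sigma> y) =
           permute_coords \<sigma> (twist c proper_subsets (a \<circ> card) (b \<circ> card) u y)"
proof -
  let ?k = "\<lambda>y A. herm y (u A) * (wind_power (a (card A)) (b (card A)) (wind c (herm y (u A))) - 1)"
  have inj: "inj \<sigma>" using \<sigma> by (rule bij_is_inj)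
  have card: "card (\<sigma> ` A) = card A" for A using inj by (meson card_image inj_on_subset subset_UNIV)
  have "bij_betw ((`) \<sigma>) proper_subsets proper_subsets"
  proof (rule bij_betw_byWitness[where f' = "(`) (inv_into UNIV \<sigma>)"])
    have im: "\<sigma> ` A \<noteq> {} \<and> \<sigma> ` A \<noteq> UNIV" if "A \<noteq> {}" "A \<noteq> UNIV" for A
      using that \<sigma> by (metis bij_def image_is_empty inj_image_eq_iff)
    have im': "inv_into UNIV \<sigma> ` A \<noteq> {} \<and> inv_into UNIV \<sigma> ` A \<noteq> UNIV" if "A \<noteq> {}" "A \<noteq> UNIV" for A
      using that bij_imp_bij_inv[OF \<sigma>] by (metis bij_def image_is_empty inj_image_eq_iff)
    show "\<forall>A\<in>proper_subsets. inv_into UNIV \<sigma> ` \<sigma> ` A = A"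
      by (simp add: image_inv_f_f inj)
    show "\<forall>A\<in>proper_subsets. \<sigma> ` inv_into UNIV \<sigma> ` A = A"
      by (simp add: image_f_inv_f bij_is_surj \<sigma>)
    show "(`) \<sigma> ` proper_subsets \<subseteq> proper_subsets"
      by (intro image_subsetI CollectI im) auto
    show "(`) (inv_into UNIV \<sigma>) ` proper_subsets \<subseteq> proper_subsets"
      by (intro image_subsetI CollectI im') auto
  qed
  from sum.reindex_bij_betw[OF this, symmetric]
  have "(\<Sum>A\<in>proper_subsets. ?k (permute_coords \<sigma> y) A *s u A) =
      (\<Sum>A\<in>proper_subsets. ?k (permute_coords \<sigma> y) (\<sigma> ` A) *s u (\<sigma> ` A))" .
  also have "\<dots> = permute_coords \<sigma> (\<Sum>A\<in>proper_subsets. ?k y A *s u A)"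
    by (simp add: u card herm_permute[OF \<sigma>] permute_coords_sum permute_coords_scale)
  finally show ?thesis by (simp add: twist_def permute_coords_add)
qed

text \<open>
  At time \<open>0\<close> the rays point to the centred indicators, which the group permutes, so the twist is
  equivariant; at time \<open>1\<close> they lie in one complex line, and the twist is null-homotopic.
  Composition with \<open>sgn\<close> extends it from the unit sphere.
\<close>
lemma null_homotopic_equivariant_self_map:
  fixes a b :: "nat \<Rightarrow> nat"
  assumes r: "5 \<le> CARD('r::finite)"
    and deg: "(\<Sum>A\<in>proper_subsets. a (card (A :: 'r set))) + 1 = (\<Sum>A\<in>proper_subsets. b (card (A :: 'r set)))"
  shows "\<exists>f p. p \<in> mean_zero - {0} \<and> f \<in> mean_zero - {0 :: complex^'r} \<rightarrow> mean_zero - {0} \<and>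
    (\<forall>\<sigma> y. bij \<sigma> \<longrightarrow> f (permute_coords \<sigma> y) = permute_coords \<sigma> (f y)) \<and>
    homotopic_with_canon (\<lambda>_. True) (mean_zero - {0}) (mean_zero - {0}) f (\<lambda>_. p)"
proof -
  let ?Z = "mean_zero - {0 :: complex^'r}" and ?S = "mean_zero \<inter> sphere (0 :: complex^'r) 1"
  \<comment> \<open>\<open>q0\<close> has pairwise different coordinates, and the numbers \<open>l A\<close> lie on different rays because they
      have the same real part.\<close>
  define q0 :: "complex^'r" where
    "q0 = (\<chi> i. of_nat (to_nat i) - (\<Sum>j\<in>UNIV. of_nat (to_nat (j :: 'r))) / of_nat CARD('r))"
  define l :: "'r set \<Rightarrow> complex" where "l A = Complex 1 (real (to_nat A))" for A
  define u where "u t A = sgn (slide l q0 t A)" for t A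
  have q0: "q0 \<in> mean_zero" "inj (\<lambda>i. q0 $ i)"
    by (auto simp: q0_def mean_zero_def sum_subtractf inj_def)
  have l: "inj l" "\<And>A. Re (l A) = 1" by (auto simp: l_def inj_def)
  have slide_nz: "slide l q0 t A \<noteq> 0" if "A \<in> proper_subsets" for t A
    using slide_not_parallel[OF r q0(2) l that order_refl, of t A] by auto
  have distinct: "A = B" if "A \<in> proper_subsets" "B \<in> proper_subsets" "u t A = u t B" for t A B
  proof -
    let ?n = "\<lambda>A. norm (slide l q0 t A)"
    have "slide l q0 t A = ?n A *\<^sub>R u t A" "u t B = inverse (?n B) *\<^sub>R slide l q0 t B"
      using slide_nz[OF that(1)] by (simp_all add: u_def sgn_div_norm)
    then have "slide l q0 t A = of_real (?n A * inverse (?n B)) *s slide l q0 t B"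
      using that(3) by (simp add: scaleR_eq_scale)
    from slide_not_parallel[OF r q0(2) l that(1) _ this] show ?thesis by simp
  qed
  have cont: "continuous_on {0..1} (\<lambda>t. u t A)" if "A \<in> proper_subsets" for A
    unfolding u_def sgn_div_norm using slide_nz[OF that] by (intro continuous_intros) auto
  have sgn_V: "sgn y \<in> mean_zero" if "y \<in> mean_zero" for y :: "complex^'r"
    unfolding sgn_div_norm scaleR_eq_scale by (intro vec.subspace_scale subspace_mean_zero that)
  have unit: "norm (u t A) = 1" if "A \<in> proper_subsets" for t A
    using slide_nz[OF that] by (simp add: u_def norm_sgn)
  have u_V: "u t A \<in> mean_zero" for t A
    unfolding u_def by (intro sgn_V slide_mean_zero q0)
  have "\<exists>c. 0 \<le> c \<and> c < 1 \<and> (\<forall>t\<in>{0..1}. separated c proper_subsets (u t))"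
    by (rule uniformly_separated[OF _ cont unit distinct]) simp_all
  then obtain c where c: "0 \<le> c" "c < 1" and sep: "\<And>t. t \<in> {0..1} \<Longrightarrow> separated c proper_subsets (u t)"
    by blast
  let ?tw = "\<lambda>t. twist c proper_subsets (a \<circ> card) (b \<circ> card) (u t)"
  have u1: "u 1 = (\<lambda>A. sgn (l A) *s sgn q0)"
    by (simp add: u_def slide_def sgn_scale fun_eq_iff)
  have "q0 \<noteq> 0"
  proof
    assume "q0 = 0"
    then have "inj (\<lambda>_ :: 'r. 0 :: complex)" using q0(2) by simp
    then have "CARD('r) \<le> card {0 :: complex}" by (rule card_inj_on_le) auto
    then show False using r by simp
  qed
  then have q: "norm (sgn q0) = 1" "sgn q0 \<in> mean_zero"
    using sgn_V[OF q0(1)] by (simp_all add: norm_sgn)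
  have "homotopic_with_canon (\<lambda>_. True) ?S ?Z (?tw 0) (?tw 1)"
    by (rule homotopic_twist[OF c _ subspace_mean_zero cont u_V sep]) auto
  moreover have "\<exists>p. homotopic_with_canon (\<lambda>_. True) ?S ?Z (?tw 1) (\<lambda>_. p)"
    unfolding u1
  proof (rule twist_collinear_null_homotopic[OF c _ subspace_mean_zero _ q])
    show "separated c proper_subsets (\<lambda>A. sgn (l A) *s sgn q0)" using sep[of 1] by (simp add: u1)
  qed (use deg in auto)
  ultimately obtain p where hom: "homotopic_with_canon (\<lambda>_. True) ?S ?Z (?tw 0) (\<lambda>_. p)"
    using homotopic_with_trans by blast
  have "p \<in> ?Z" using homotopic_with_imp_funspace2[OF hom] q by auto
  have sgn_cont: "continuous_on ?Z sgn" unfolding sgn_div_norm by (intro continuous_intros) auto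
  have sgn_in: "sgn \<in> ?Z \<rightarrow> ?S"
    using sgn_V by (auto simp: norm_sgn)
  have "homotopic_with_canon (\<lambda>_. True) ?Z ?Z (?tw 0 \<circ> sgn) ((\<lambda>_. p) \<circ> sgn)"
    by (rule homotopic_with_compose_continuous_right[OF hom sgn_cont sgn_in])
  then have "homotopic_with_canon (\<lambda>_. True) ?Z ?Z (?tw 0 \<circ> sgn) (\<lambda>_. p)" by (simp add: o_def)
  moreover have "(?tw 0 \<circ> sgn) (permute_coords \<sigma> y) = permute_coords \<sigma> ((?tw 0 \<circ> sgn) y)" if "bij \<sigma>" for \<sigma> y
    unfolding o_apply sgn_permute[OF that]
  proof (rule twist_permute[unfolded o_def, OF that])
    show "u 0 (\<sigma> ` A) = permute_coords \<sigma> (u 0 A)" for A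
      by (simp add: u_def slide_def centred_indicator_permute that sgn_permute)
  qed
  ultimately show ?thesis
    using \<open>p \<in> ?Z\<close> by (intro exI[of _ "?tw 0 \<circ> sgn"] exI[of _ p]) (blast dest: homotopic_with_imp_funspace1)
qed

section \<open>Simplicial actions and the theorem\<close>

text \<open>
  On a simplex, a map that respects segments is the restriction of an affine map of the whole space:
  the vertices are affinely independent, so there is an affine map \<open>A\<close> with the same values at them,
  and the set where the two agree is convex.
\<close>
lemma affine_map_on_simplex_continuous:
  fixes f :: "'a::euclidean_space \<Rightarrow> 'b::euclidean_space"
  assumes C: "\<not> affine_dependent C" and f: "affine_map_on (convex hull C) f"
  shows "continuous_on (convex hull C) f"
proof (cases "C = {}")
  case False
  then obtain c where c: "c \<in> C" by blast
  let ?B = "(\<lambda>x. - c + x) ` (C - {c})"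
  have "independent ?B"
    using C affine_dependent_iff_dependent2[OF c] by simp
  from linear_independent_extend[OF this, of "\<lambda>x. f (c + x) - f c"]
  obtain g where g: "linear g" "\<forall>x\<in>?B. g x = f (c + x) - f c" by blast
  define A where "A x = g (x - c) + f c" for x
  have A_C: "f x = A x" if "x \<in> C" for x
  proof (cases "x = c")
    case True
    then show ?thesis using linear_0[OF g(1)] by (simp add: A_def)
  next
    case False
    then have "- c + x \<in> ?B" using that by blast
    with g(2) have "g (- c + x) = f (c + (- c + x)) - f c" by blast
    then show ?thesis by (simp add: A_def)
  qed
  have "convex {x \<in> convex hull C. f x = A x}"
  proof (rule convex_alt[THEN iffD2], intro ballI allI impI)
    fix x y and t :: real
    assume "x \<in> {x \<in> convex hull C. f x = A x}" "y \<in> {x \<in> convex hull C. f x = A x}"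
      and t: "0 \<le> t \<and> t \<le> 1"
    then have x: "x \<in> convex hull C" "f x = A x" and y: "y \<in> convex hull C" "f y = A y" by auto
    have "f ((1 - t) *\<^sub>R x + t *\<^sub>R y) = (1 - t) *\<^sub>R A x + t *\<^sub>R A y"
      using f x y t by (simp add: affine_map_on_def)
    also have "\<dots> = (1 - t) *\<^sub>R g (x - c) + t *\<^sub>R g (y - c) + f c"
      by (simp add: A_def algebra_simps)
    also have "\<dots> = g ((1 - t) *\<^sub>R (x - c) + t *\<^sub>R (y - c)) + f c"
      using g(1) by (simp add: linear_add linear_scale)
    also have "(1 - t) *\<^sub>R (x - c) + t *\<^sub>R (y - c) = (1 - t) *\<^sub>R x + t *\<^sub>R y - c"
      by (simp add: algebra_simps)
    finally have "f ((1 - t) *\<^sub>R x + t *\<^sub>R y) = A ((1 - t) *\<^sub>R x + t *\<^sub>R y)" by (simp add: A_def)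
    moreover have "(1 - t) *\<^sub>R x + t *\<^sub>R y \<in> convex hull C"
      using convex_convex_hull[of C] x y t by (simp add: convex_alt)
    ultimately show "(1 - t) *\<^sub>R x + t *\<^sub>R y \<in> {x \<in> convex hull C. f x = A x}" by blast
  qed
  moreover have "C \<subseteq> {x \<in> convex hull C. f x = A x}" using A_C by (auto intro: hull_inc)
  ultimately have "convex hull C \<subseteq> {x \<in> convex hull C. f x = A x}" by (intro hull_minimal)
  then have "\<And>x. x \<in> convex hull C \<Longrightarrow> A x = f x" by auto
  moreover have "continuous_on (convex hull C) A"
  proof -
    have "bounded_linear g" using g(1) by (simp add: linear_conv_bounded_linear)
    then show ?thesis unfolding A_def
      by (intro continuous_on_add continuous_on_const continuous_on_diff continuous_on_id
        bounded_linear.continuous_on[of g])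
  qed
  ultimately show ?thesis by (simp cong: continuous_on_cong)
qed simp

lemma simplicial_map_continuous:
  assumes T: "simplicial_complex T" and f: "simplicial_map T L f"
  shows "continuous_on (\<Union>T) f"
proof -
  have fin: "finite T" and simp: "\<And>S. S \<in> T \<Longrightarrow> \<exists>n. n simplex S"
    using T by (auto simp: simplicial_complex_def)
  have "continuous_on (\<Union>S\<in>T. S) f"
  proof (rule continuous_on_closed_Union[OF fin])
    fix S assume S: "S \<in> T"
    obtain C where C: "finite C" "\<not> affine_dependent C" "S = convex hull C"
      using simp[OF S] unfolding simplex by blast
    show "closed S" using C by (simp add: compact_imp_closed finite_imp_compact_convex_hull)
    show "continuous_on S f"
      using affine_map_on_simplex_continuous[OF C(2)] f S C(3) by (auto simp: simplicial_map_def)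
  qed
  then show ?thesis by simp
qed

lemma compact_body:
  assumes "simplicial_complex T" shows "compact (\<Union>T)"
proof (rule compact_Union)
  show "finite T" using assms by (simp add: simplicial_complex_def)
  fix S assume "S \<in> T"
  then obtain n where "n simplex S" using assms unfolding simplicial_complex_def by blast
  then show "compact S" unfolding simplex by (auto intro: finite_imp_compact_convex_hull)
qed

lemma complex_action_continuous_action:
  assumes "group G" and act: "complex_action G K \<phi>"
  shows "continuous_action G (\<Union>K) \<phi>"
proof -
  have ga: "group_action G (\<Union>K) \<phi>" using act by (simp add: complex_action_def)
  interpret group_action G "\<Union>K" \<phi> by (rule ga)
  obtain T where T: "simplicial_complex T" "\<Union>T = \<Union>K" "\<And>g. g \<in> carrier G \<Longrightarrow> simplicial_map T T (\<phi> g)"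
    using act by (auto simp: complex_action_def)
  show ?thesis
  proof (rule continuous_action.intro[OF assms(1)], unfold_locales)
    fix g h x
    show "x \<in> \<Union>K \<Longrightarrow> \<phi> \<one>\<^bsub>G\<^esub> x = x" by (simp flip: id_eq_one)
    show "g \<in> carrier G \<Longrightarrow> x \<in> \<Union>K \<Longrightarrow> \<phi> g x \<in> \<Union>K" by (rule element_image) auto
    show "g \<in> carrier G \<Longrightarrow> h \<in> carrier G \<Longrightarrow> x \<in> \<Union>K \<Longrightarrow> \<phi> (g \<otimes>\<^bsub>G\<^esub> h) x = \<phi> g (\<phi> h x)"
      by (rule composition_rule)
    show "g \<in> carrier G \<Longrightarrow> continuous_on (\<Union>K) (\<phi> g)"
      using simplicial_map_continuous[OF T(1,3)] T(2) by simp
  qed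
qed

lemma carrier_BijGroup_UNIV [simp]: "carrier (BijGroup UNIV) = {\<sigma>. bij \<sigma>}"
  by (auto simp: BijGroup_def Bij_def)

lemma mult_BijGroup_UNIV: "bij \<sigma> \<Longrightarrow> bij \<tau> \<Longrightarrow> \<sigma> \<otimes>\<^bsub>BijGroup UNIV\<^esub> \<tau> = \<sigma> \<circ> \<tau>"
  by (simp add: BijGroup_def Bij_def compose_def fun_eq_iff)

lemma one_BijGroup_UNIV: "\<one>\<^bsub>BijGroup UNIV\<^esub> = id"
  by (simp add: BijGroup_def fun_eq_iff)

lemma permute_coords_action:
  "continuous_action (BijGroup (UNIV :: 'r::finite set)) (mean_zero - {0}) permute_coords"
proof (rule continuous_action.intro[OF group_BijGroup], unfold_locales)
  fix \<sigma> \<tau> :: "'r \<Rightarrow> 'r" and y :: "complex^'r"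
  assume \<sigma>: "\<sigma> \<in> carrier (BijGroup UNIV)"
  show "continuous_on (mean_zero - {0}) (permute_coords \<sigma>)"
    unfolding permute_coords_def by (intro continuous_intros)
  show "permute_coords \<sigma> y \<in> mean_zero - {0}" if "y \<in> mean_zero - {0}"
    using that \<sigma> norm_permute[of \<sigma> y] permute_coords_mean_zero[of \<sigma> y] by auto
  show "permute_coords (\<sigma> \<otimes>\<^bsub>BijGroup UNIV\<^esub> \<tau>) y = permute_coords \<sigma> (permute_coords \<tau> y)"
    if "\<tau> \<in> carrier (BijGroup UNIV)"
    using \<sigma> that by (simp add: mult_BijGroup_UNIV permute_coords_def o_inv_distrib)
next
  fix y :: "complex^'r"
  show "permute_coords \<one>\<^bsub>BijGroup UNIV\<^esub> y = y"
    by (simp add: one_BijGroup_UNIV permute_coords_def)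
qed

lemma five_le_card_if_not_prime_power:
  assumes "\<nexists>p k :: nat. prime p \<and> CARD('r::finite) = p ^ k"
  shows "5 \<le> CARD('r)"
proof (rule ccontr)
  assume "\<not> 5 \<le> CARD('r)"
  moreover have "0 < CARD('r)" by simp
  ultimately have "CARD('r) = 1 \<or> CARD('r) = 2 \<or> CARD('r) = 3 \<or> CARD('r) = 4" by linarith
  then have "CARD('r) = 2 ^ 0 \<or> CARD('r) = 2 ^ 1 \<or> CARD('r) = 3 ^ 1 \<or> CARD('r) = 2 ^ 2" by auto
  moreover have "prime (2 :: nat)" "prime (3 :: nat)" by simp_all
  ultimately show False using assms by metis
qed

definition real_columns :: "complex^'r \<Rightarrow> real^2^'r" where
  "real_columns y = (\<chi> i k. if k = 1 then Re (y $ i) else Im (y $ i))"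

lemma continuous_on_real_columns: "continuous_on S real_columns"
proof -
  have "continuous_on S (\<lambda>y. if k = 1 then Re (y $ i) else Im (y $ i))" for i and k :: 2
    by (cases "k = 1") (auto intro!: continuous_intros)
  then show ?thesis unfolding real_columns_def by (intro continuous_on_vec_lambda)
qed

lemma real_columns_permute:
  "real_columns (permute_coords \<sigma> y) = permute_columns \<sigma> (real_columns y)"
  by (simp add: real_columns_def permute_columns_def vec_eq_iff)

lemma real_columns_not_diagonal:
  fixes y :: "complex^'r::finite"
  assumes y: "y \<in> mean_zero - {0}"
  shows "real_columns y \<notin> diagonal"
proof
  assume "real_columns y \<in> diagonal"
  then obtain x where x: "\<And>i. real_columns y $ i = x" by (auto simp: diagonal_def)
  have "y $ i = Complex (x $ 1) (x $ 2)" for i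
    using x[of i] by (auto simp: real_columns_def complex_eq_iff)
  then have y_eq: "y $ i = w" if "w = Complex (x $ 1) (x $ 2)" for i w using that by simp
  then have "of_nat CARD('r) * Complex (x $ 1) (x $ 2) = 0" using y by (simp add: mean_zero_def)
  then have "y = 0" using y_eq by (simp add: vec_eq_iff)
  then show False using y by simp
qed

theorem theorem2p2:
  fixes K :: "'a::euclidean_space set set"
    and \<phi> :: "('r::finite \<Rightarrow> 'r) \<Rightarrow> 'a \<Rightarrow> 'a"
  assumes not_prime_power: "\<nexists>p k :: nat. prime p \<and> CARD('r) = p ^ k"
    and complex: "simplicial_complex K"
    and action: "complex_action (BijGroup (UNIV :: 'r set)) K \<phi>"
    and free: "free_action (BijGroup (UNIV :: 'r set)) (\<Union>K) \<phi>"
  shows "\<exists>f :: 'a \<Rightarrow> real^2^'r.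
           continuous_on (\<Union>K) f \<and>
           f \<in> \<Union>K \<rightarrow> UNIV - diagonal \<and>
           (\<forall>\<sigma>\<in>carrier (BijGroup (UNIV :: 'r set)). \<forall>x\<in>\<Union>K.
              f (\<phi> \<sigma> x) = permute_columns \<sigma> (f x))"
proof -
  let ?G = "BijGroup (UNIV :: 'r set)" and ?Z = "mean_zero - {0 :: complex^'r}"
  obtain a b where "(\<Sum>k\<in>{0<..<CARD('r)}. (CARD('r) choose k) * a k) + 1 =
      (\<Sum>k\<in>{0<..<CARD('r)}. (CARD('r) choose k) * b k)"
    using binomial_combination[OF _ not_prime_power] by auto
  then have deg: "(\<Sum>A\<in>proper_subsets. a (card (A :: 'r set))) + 1 =
      (\<Sum>A\<in>proper_subsets. b (card (A :: 'r set)))"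
    by (simp only: sum_proper_subsets_card)
  from null_homotopic_equivariant_self_map[OF five_le_card_if_not_prime_power[OF not_prime_power] deg]
  obtain f p where p: "p \<in> ?Z" and f: "f \<in> ?Z \<rightarrow> ?Z"
      "\<And>\<sigma> y. bij \<sigma> \<Longrightarrow> f (permute_coords \<sigma> y) = permute_coords \<sigma> (f y)"
    and hom: "homotopic_with_canon (\<lambda>_. True) ?Z ?Z f (\<lambda>_. p)"
    by blast
  have f_cont: "continuous_on ?Z f" using homotopic_with_imp_continuous[OF hom] by blast
  obtain h :: "real \<times> (complex^'r) \<Rightarrow> complex^'r" where
      h: "continuous_on ({0..1} \<times> ?Z) h" "h \<in> {0..1} \<times> ?Z \<rightarrow> ?Z"
      "\<And>z. h (0, z) = f z" "\<And>z. h (1, z) = p"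
    using hom unfolding homotopic_with_def by (auto simp: prod_topology_subtopology_eu)
  interpret null_homotopic_target ?G "\<Union>K" \<phi> ?Z permute_coords f h p
  proof (intro null_homotopic_target.intro null_homotopic_target_axioms.intro)
    show "continuous_action ?G (\<Union>K) \<phi>"
      by (rule complex_action_continuous_action[OF group_BijGroup action])
    show "continuous_action ?G ?Z permute_coords" by (rule permute_coords_action)
    show "equivariant_map ?G permute_coords permute_coords ?Z ?Z f"
      using f f_cont by (simp add: equivariant_map_def)
    show "finite (carrier ?G)" by simp
    show "continuous_on ({0..1} \<times> ?Z) h" "h \<in> {0..1} \<times> ?Z \<rightarrow> ?Z" by (rule h)+
    show "h (0, z) = f z" "h (1, z) = p" for z by (rule h)+
    show "p \<in> ?Z" by (rule p)
  qed
  have "\<sigma> = \<one>\<^bsub>?G\<^esub>" if "\<sigma> \<in> carrier ?G" "x \<in> \<Union>K" "\<phi> \<sigma> x = x" for \<sigma> x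
    using free that by (auto simp: free_action_def stabilizer_def)
  from equivariant_map_exists[OF compact_body[OF complex] this]
  obtain F where "equivariant_map ?G \<phi> permute_coords (\<Union>K) ?Z F" ..
  then have F: "continuous_on (\<Union>K) F" "F \<in> \<Union>K \<rightarrow> ?Z"
      "\<forall>\<sigma>\<in>carrier ?G. \<forall>x\<in>\<Union>K. F (\<phi> \<sigma> x) = permute_coords \<sigma> (F x)"
    unfolding equivariant_map_def by blast+
  show ?thesis
  proof (intro exI[of _ "real_columns \<circ> F"] conjI ballI)
    show "continuous_on (\<Union>K) (real_columns \<circ> F)"
      by (rule continuous_on_compose[OF F(1) continuous_on_real_columns])
    show "real_columns \<circ> F \<in> \<Union>K \<rightarrow> UNIV - diagonal"
    proof
      fix x assume "x \<in> \<Union>K"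
      with F(2) have "F x \<in> ?Z" by (rule funcset_mem)
      then show "(real_columns \<circ> F) x \<in> UNIV - diagonal" using real_columns_not_diagonal by simp
    qed
    show "(real_columns \<circ> F) (\<phi> \<sigma> x) = permute_columns \<sigma> ((real_columns \<circ> F) x)"
      if "\<sigma> \<in> carrier ?G" "x \<in> \<Union>K" for \<sigma> x
      unfolding o_apply real_columns_permute[symmetric] bspec[OF bspec[OF F(3) that(1)] that(2)] ..
  qed
qed

end
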